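(* Let $H_\psi$ denote the Hankel operator on $H^2$ corresponding to Hilbert's Hankel matrix $\Gamma=\big\{\frac{1}{m+n+1}\big\}_{m,n=0}^\infty$. Then \[ \{u H^2: u \in H^\infty(\mathbb{D}) \text{ inner}\} \cap \mathrm{Lat}\, H_\psi = \{H^2\}. \]
   Context: $\mathbb{T}$ is the unit circle and $\mathbb{D}$ the open unit disc. $H^2\subseteq L^2(\mathbb{T})$ is the Hardy space (functions whose negative Fourier coefficients vanish), $P_+$ is the orthogonal projection of $L^2(\mathbb{T})$ onto $H^2$, and $(Jf)(z)=f(\bar z)$ on $L^2(\mathbb{T})$. For $\varphi\in L^\infty(\mathbb{T})$, the Hankel operator $H_\varphi$ on $H^2$ is $H_\varphi f=P_+(\varphi\, Jf)$. The symbol $\psi\in L^\infty(\mathbb{T})$ is $\psi(e^{it})=ie^{-it}(\pi-t)$ for $t\in[0,2\pi)$; the matrix of $H_\psi$ in the basis $\{z^n\}_{n\ge0}$ is $\Gamma$. $H^\infty(\mathbb{D})$ is the algebra of bounded analytic functions on $\mathbb{D}$; $u\in H^\infty(\mathbb{D})$ is inner if its radial limits satisfy $|u|=1$ a.e. on $\mathbb{T}$ (unimodular constants are inner). $\mathrm{Lat}\,A$ is the lattice of closed subspaces invariant under the operator $A$. *)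

theory Defs
  imports "HOL-Complex_Analysis.Complex_Analysis"
begin

text \<open>
  Elements of \<open>L\<^sup>2(\<T>)\<close> are represented by Borel functions on the complex plane, of which only the
  values on the unit circle matter; equality in \<open>L\<^sup>2(\<T>)\<close> is equality almost everywhere with respect
  to normalized arc length. Subspaces of \<open>L\<^sup>2(\<T>)\<close> are represented by sets of functions that are
  saturated under this equality, so that equality of sets of functions is equality of subspaces.
\<close>

definition circle_measure :: "complex measure" where
  "circle_measure = distr (uniform_measure lborel {0..<2 * pi}) borel cis"

definition L2T :: "(complex \<Rightarrow> complex) set" where
  "L2T = {f \<in> borel_measurable circle_measure. integrable circle_measure (\<lambda>z. (cmod (f z))\<^sup>2)}"

definition l2_inner :: "(complex \<Rightarrow> complex) \<Rightarrow> (complex \<Rightarrow> complex) \<Rightarrow> complex" where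
  "l2_inner f g = (\<integral>z. f z * cnj (g z) \<partial>circle_measure)"

definition l2_norm :: "(complex \<Rightarrow> complex) \<Rightarrow> real" where
  "l2_norm f = sqrt (\<integral>z. (cmod (f z))\<^sup>2 \<partial>circle_measure)"

definition fourier_coeff :: "(complex \<Rightarrow> complex) \<Rightarrow> int \<Rightarrow> complex" where
  "fourier_coeff f n = l2_inner f (\<lambda>z. z powi n)"

definition H2 :: "(complex \<Rightarrow> complex) set" where
  "H2 = {f \<in> L2T. \<forall>n<0. fourier_coeff f n = 0}"

text \<open>
  A representative of the orthogonal projection of \<open>f \<in> L\<^sup>2(\<T>)\<close> onto \<open>H\<^sup>2\<close>; it is determined
  up to equality almost everywhere.
\<close>

definition P_plus :: "(complex \<Rightarrow> complex) \<Rightarrow> complex \<Rightarrow> complex" where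
  "P_plus f = (SOME g. g \<in> H2 \<and> (\<forall>h\<in>H2. l2_inner (\<lambda>z. f z - g z) h = 0))"

definition J :: "(complex \<Rightarrow> complex) \<Rightarrow> complex \<Rightarrow> complex" where
  "J f = (\<lambda>z. f (cnj z))"

text \<open>Intended for essentially bounded \<open>\<phi>\<close>, such as \<open>hilbert_symbol\<close> below.\<close>

definition hankel :: "(complex \<Rightarrow> complex) \<Rightarrow> (complex \<Rightarrow> complex) \<Rightarrow> complex \<Rightarrow> complex" where
  "hankel \<phi> f = P_plus (\<lambda>z. \<phi> z * J f z)"

text \<open>\<^const>\<open>Arg2pi\<close> takes its values in \<open>[0, 2\<pi>)\<close>.\<close>

definition hilbert_symbol :: "complex \<Rightarrow> complex" where
  "hilbert_symbol z = (let t = Arg2pi z in \<i> * cis (- t) * complex_of_real (pi - t))"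

lemma hilbert_symbol_measurable: "hilbert_symbol \<in> borel_measurable borel"
proof -
  have closed: "closed (\<real>\<^sub>\<ge>\<^sub>0 :: complex set)"
    by simp
  have "(\<lambda>z. if z \<in> \<real>\<^sub>\<ge>\<^sub>0 then 0 else Arg2pi z) \<in> borel_measurable borel"
    using closed
    by (intro borel_measurable_continuous_on_if continuous_intros)
       (auto intro!: continuous_at_imp_continuous_on continuous_at_Arg2pi)
  also have "(\<lambda>z. if z \<in> \<real>\<^sub>\<ge>\<^sub>0 then 0 else Arg2pi z) = Arg2pi"
    by (auto simp: fun_eq_iff Arg2pi_eq_0 nonneg_Reals_def)
  finally have [measurable]: "Arg2pi \<in> borel_measurable borel" .
  have [measurable]: "cis \<in> borel_measurable borel"
    by (intro borel_measurable_continuous_onI continuous_intros)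
  show ?thesis
    unfolding hilbert_symbol_def[abs_def] Let_def by measurable
qed

text \<open>
  Projecting to \<open>H\<^sup>2\<close> does not change the coefficients with nonnegative index, so the following
  says that the matrix of \<^term>\<open>hankel hilbert_symbol\<close> with respect to the orthonormal basis
  \<open>{z\<^sup>n}\<close> of \<open>H\<^sup>2\<close> is Hilbert's matrix.
\<close>

lemma fourier_coeff_hilbert_symbol:
  "fourier_coeff (\<lambda>z. hilbert_symbol z * J (\<lambda>z. z ^ n) z) (int m) = 1 / of_nat (m + n + 1)"
proof -
  note [measurable] = hilbert_symbol_measurable
  have [measurable]: "cis \<in> borel_measurable borel"
    by (intro borel_measurable_continuous_onI continuous_intros)
  have [measurable]: "cnj \<in> borel_measurable borel"
    by (intro borel_measurable_continuous_onI continuous_intros)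
  define N where "N = m + n + 1"
  have N: "of_nat N \<noteq> (0 :: complex)" unfolding N_def by (simp only: of_nat_eq_0_iff)
  define h where "h = (\<lambda>z. hilbert_symbol z * cnj z ^ n * cnj (z ^ m))"
  have [measurable]: "h \<in> borel_measurable borel" unfolding h_def by measurable
  define f where "f = (\<lambda>t. \<i> * of_real (pi - t) * exp (- (\<i> * of_nat N * of_real t)))"
  define G where "G = (\<lambda>t::complex. - (of_real pi - t) * exp (- (\<i> * of_nat N * t)) / of_nat N
                          - \<i> * exp (- (\<i> * of_nat N * t)) / (of_nat N)\<^sup>2)"
  have um: "uniform_measure lborel {0..<2*pi} = density lborel (\<lambda>x. ennreal (indicator {0..<2*pi} x / (2*pi)))"
    unfolding uniform_measure_def
    by (intro arg_cong2[where f = density] refl ext)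
       (simp add: indicator_def divide_ennreal flip: ennreal_1)
  have hf: "h (cis t) = f t" if "0 \<le> t" "t < 2 * pi" for t
  proof -
    have "Arg2pi (cis t) = t"
      using that by (intro Arg2pi_unique[where r = 1]) (auto simp: cis_conv_exp)
    hence "h (cis t) = \<i> * of_real (pi - t) * (cis (- t) * cis (- t) ^ n * cis (- t) ^ m)"
      by (simp add: h_def hilbert_symbol_def Let_def cis_cnj)
    also have "cis (- t) * cis (- t) ^ n * cis (- t) ^ m = cis (- t) ^ N"
      by (simp add: N_def power_add mult_ac)
    also have "\<dots> = exp (- (\<i> * of_nat N * of_real t))"
      unfolding Complex.DeMoivre by (simp add: cis_conv_exp mult_ac)
    finally show ?thesis by (simp add: f_def)
  qed
  have "fourier_coeff (\<lambda>z. hilbert_symbol z * J (\<lambda>z. z ^ n) z) (int m) = (\<integral>z. h z \<partial>circle_measure)"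
    by (simp add: fourier_coeff_def l2_inner_def J_def h_def)
  also have "\<dots> = (\<integral>t. h (cis t) \<partial>uniform_measure lborel {0..<2*pi})"
    unfolding circle_measure_def by (intro integral_distr) auto
  also have "\<dots> = (\<integral>t. (indicator {0..<2*pi} t / (2*pi)) *\<^sub>R h (cis t) \<partial>lborel)"
    unfolding um by (intro integral_density) auto
  also have "\<dots> = (\<integral>t. (1 / (2*pi)) *\<^sub>R (indicator {0..2*pi} t *\<^sub>R f t) \<partial>lborel)"
  proof (intro integral_cong_AE)
    show "AE t in lborel. (indicator {0..<2*pi} t / (2*pi)) *\<^sub>R h (cis t) =
            (1 / (2*pi)) *\<^sub>R (indicator {0..2*pi} t *\<^sub>R f t)"
      using AE_lborel_singleton[of "2*pi"]
      by eventually_elim (auto simp: indicator_def hf)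
  qed (auto simp: f_def)
  also have "\<dots> = (1 / (2*pi)) *\<^sub>R (\<integral>t. indicator {0..2*pi} t *\<^sub>R f t \<partial>lborel)"
    by (rule integral_scaleR_right)
  also have "(\<integral>t. indicator {0..2*pi} t *\<^sub>R f t \<partial>lborel) = G (of_real (2*pi)) - G (of_real 0)"
  proof (rule integral_FTC_Icc)
    fix t :: real
    have "(G has_field_derivative f t) (at (of_real t))"
      unfolding G_def f_def using N
      by (auto intro!: derivative_eq_intros simp: field_simps power2_eq_square)
    thus "((\<lambda>t. G (of_real t)) has_vector_derivative f t) (at t within {0..2*pi})"
      by (intro has_vector_derivative_real_field) (auto intro: DERIV_subset)
  qed (auto simp: f_def intro!: continuous_intros)
  also have "\<dots> = of_real (2 * pi) / of_nat N"
  proof -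
    have "exp (\<i> * of_nat N * of_real (2*pi)) = cis (2 * pi) ^ N"
      unfolding Complex.DeMoivre by (simp add: cis_conv_exp mult_ac)
    hence "exp (- (\<i> * of_nat N * of_real (2*pi))) = 1"
      by (simp only: exp_minus) simp
    thus ?thesis
      using N unfolding G_def by (simp add: field_simps)
  qed
  finally show ?thesis by (simp add: N_def scaleR_conv_of_real)
qed

definition Hinf :: "(complex \<Rightarrow> complex) set" where
  "Hinf = {u. u holomorphic_on ball 0 1 \<and> bounded (u ` ball 0 1)}"

definition inner_function :: "(complex \<Rightarrow> complex) \<Rightarrow> bool" where
  "inner_function u \<longleftrightarrow> u \<in> Hinf \<and>
     (AE z in circle_measure. \<exists>l. ((\<lambda>r. u (complex_of_real r * z)) \<longlongrightarrow> l) (at_left 1) \<and> cmod l = 1)"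

definition radial_limit :: "(complex \<Rightarrow> complex) \<Rightarrow> complex \<Rightarrow> complex" where
  "radial_limit u z = Lim (at_left 1) (\<lambda>r. u (complex_of_real r * z))"

text \<open>
  \<open>u H\<^sup>2\<close>, where \<open>u\<close> is identified with its boundary function, as a subspace of \<open>L\<^sup>2(\<T>)\<close>.
\<close>

definition mult_H2 :: "(complex \<Rightarrow> complex) \<Rightarrow> (complex \<Rightarrow> complex) set" where
  "mult_H2 u = {g \<in> L2T. \<exists>f\<in>H2. AE z in circle_measure. g z = radial_limit u z * f z}"

text \<open>
  Saturation under equality almost everywhere is part of closedness: take a constant sequence.
\<close>

definition closed_subspace_H2 :: "(complex \<Rightarrow> complex) set \<Rightarrow> bool" where
  "closed_subspace_H2 M \<longleftrightarrow> M \<subseteq> H2 \<and> (\<lambda>z. 0) \<in> M \<and>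
     (\<forall>f\<in>M. \<forall>g\<in>M. (\<lambda>z. f z + g z) \<in> M) \<and> (\<forall>c. \<forall>f\<in>M. (\<lambda>z. c * f z) \<in> M) \<and>
     (\<forall>F f. (\<forall>n. F n \<in> M) \<and> f \<in> H2 \<and> (\<lambda>n::nat. l2_norm (\<lambda>z. F n z - f z)) \<longlonglongrightarrow> 0 \<longrightarrow> f \<in> M)"

definition Lat :: "((complex \<Rightarrow> complex) \<Rightarrow> complex \<Rightarrow> complex) \<Rightarrow> (complex \<Rightarrow> complex) set set" where
  "Lat A = {M. closed_subspace_H2 M \<and> A ` M \<subseteq> M}"

end

theory Submission
  imports Defs
begin

text \<open>
  Let \<open>M = u H\<^sup>2\<close> be invariant under \<open>\<Gamma> = H\<^sub>\<psi>\<close>. The argument rests on two properties of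
  \<open>\<Gamma>\<close>: it is a Hankel operator, and it kills no inner function.

  A Hankel operator intertwines the shift with its adjoint, \<open>\<Gamma> S = S\<^sup>* \<Gamma>\<close>, so for every \<open>g \<in> M\<close>
  the function \<open>\<Gamma> g - z \<Gamma> (z g) = \<Gamma> g - S S\<^sup>* \<Gamma> g\<close> is the constant \<open>\<langle>\<Gamma> g, 1\<rangle>\<close>
  (\<open>hankel_shift\<close>). As \<open>M\<close> is invariant under both \<open>\<Gamma>\<close> and the shift, this constant lies in \<open>M\<close>.
  There are two cases.

  If the constant is nonzero for some \<open>g \<in> M\<close>, then \<open>1 \<in> u H\<^sup>2\<close>. Hence the conjugate of the boundary
  function of \<open>u\<close> lies in \<open>H\<^sup>2\<close> along with that function itself, so \<open>u\<close> is constant and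
  \<open>u H\<^sup>2 = H\<^sup>2\<close> (\<open>one_in_mult_H2_imp\<close>).

  Otherwise \<open>\<langle>\<Gamma> g, 1\<rangle> = 0\<close> for all \<open>g \<in> M\<close>, in particular for \<open>g = z\<^sup>k u\<close>. Since \<open>1 / (m + n + 1)\<close> is a
  moment of Lebesgue measure on \<open>[0, 1)\<close>, the functional \<open>g \<mapsto> \<langle>\<Gamma> g, 1\<rangle>\<close> is integration over \<open>[0, 1)\<close>
  (\<open>hilbert_symbol_boundary_moment\<close>). So all moments of \<open>u\<close> on \<open>[0, 1)\<close> vanish, hence \<open>u\<close> vanishes on
  \<open>[0, 1)\<close> by Weierstrass approximation and on the disc by the identity theorem
  (\<open>Hinf_zero_moments\<close>), which contradicts \<open>|u| = 1\<close> almost everywhere on the circle.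

  Conversely \<open>H\<^sup>2 = 1 H\<^sup>2\<close>, and \<open>H\<^sup>2\<close> is invariant once the projection \<open>P\<^sub>+\<close> exists. This rests on the
  completeness of \<open>L\<^sup>2(\<T>)\<close> (\<open>L2T_complete\<close>) and on minimizing the distance to a closed subspace
  (\<open>l2_projection_exists\<close>).

  Functions are recovered from their Fourier coefficients in two ways: a difference with vanishing
  coefficients is shown to be orthogonal to itself (\<open>hankel_shift\<close>), and for boundary values the
  coefficients are the Taylor coefficients in the disc (\<open>fourier_coeff_boundary\<close>).
\<close>

section \<open>The space of square-integrable functions on the circle\<close>

lemma sets_circle_measure [measurable_cong]: "sets circle_measure = sets borel"
  by (simp add: circle_measure_def)

lemma space_circle_measure [simp]: "space circle_measure = UNIV"
  by (simp add: circle_measure_def)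

lemma cis_measurable [measurable]: "cis \<in> borel_measurable borel"
  by (intro borel_measurable_continuous_onI continuous_intros)

lemma cnj_measurable [measurable]: "cnj \<in> borel_measurable borel"
  by (intro borel_measurable_continuous_onI continuous_intros)

lemma emeasure_circle_measure: "emeasure circle_measure UNIV = 1"
  by (simp add: circle_measure_def emeasure_distr emeasure_uniform_measure ennreal_divide_self)

lemma measure_circle_measure [simp]: "measure circle_measure UNIV = 1"
  by (simp add: measure_def emeasure_circle_measure)

interpretation circle: finite_measure circle_measure
  by (rule finite_measureI) (simp add: emeasure_circle_measure)

lemma AE_circle_const: "(AE z in circle_measure. P) \<longleftrightarrow> P"
proof -
  have "ae_filter circle_measure \<noteq> bot"
    by (simp add: ae_filter_eq_bot_iff emeasure_circle_measure)
  thus ?thesis by simp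
qed

lemma AE_circle_cmod: "AE z in circle_measure. cmod z = 1"
  unfolding circle_measure_def by (subst AE_distr_iff) auto

lemma powi_measurable [measurable]: "(\<lambda>z::complex. z powi n) \<in> borel_measurable borel"
  unfolding power_int_def by (cases "n \<ge> 0") simp_all

lemma AE_circle_powi: "AE z in circle_measure. cmod (z powi n) = 1"
  using AE_circle_cmod by eventually_elim (simp add: norm_power_int)

lemma L2T_measurable [measurable_dest]: "f \<in> L2T \<Longrightarrow> f \<in> borel_measurable borel"
  by (simp add: L2T_def measurable_cong_sets[OF sets_circle_measure refl])

lemma L2T_I:
  "f \<in> borel_measurable borel \<Longrightarrow> integrable circle_measure (\<lambda>z. (cmod (f z))\<^sup>2) \<Longrightarrow> f \<in> L2T"
  by (simp add: L2T_def measurable_cong_sets[OF sets_circle_measure refl])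

lemma L2T_integrable_square: "f \<in> L2T \<Longrightarrow> integrable circle_measure (\<lambda>z. (cmod (f z))\<^sup>2)"
  by (simp add: L2T_def)

lemma L2T_add [intro]:
  assumes "f \<in> L2T" "g \<in> L2T"
  shows "(\<lambda>z. f z + g z) \<in> L2T"
proof (rule L2T_I)
  note [measurable] = L2T_measurable[OF assms(1)] L2T_measurable[OF assms(2)]
  show "(\<lambda>z. f z + g z) \<in> borel_measurable borel" by measurable
  show "integrable circle_measure (\<lambda>z. (cmod (f z + g z))\<^sup>2)"
  proof (rule Bochner_Integration.integrable_bound)
    show "integrable circle_measure (\<lambda>z. 2 * (cmod (f z))\<^sup>2 + 2 * (cmod (g z))\<^sup>2)"
      by (intro Bochner_Integration.integrable_add integrable_mult_right L2T_integrable_square assms)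
    have "(cmod (a + b))\<^sup>2 \<le> 2 * (cmod a)\<^sup>2 + 2 * (cmod b)\<^sup>2" for a b
    proof -
      have "(cmod (a + b))\<^sup>2 \<le> (cmod a + cmod b)\<^sup>2"
        by (intro power_mono norm_triangle_ineq) auto
      also have "\<dots> \<le> 2 * (cmod a)\<^sup>2 + 2 * (cmod b)\<^sup>2"
        using zero_le_power2[of "cmod a - cmod b"] by (simp add: power2_eq_square algebra_simps)
      finally show ?thesis .
    qed
    thus "AE z in circle_measure. norm ((cmod (f z + g z))\<^sup>2) \<le> norm (2 * (cmod (f z))\<^sup>2 + 2 * (cmod (g z))\<^sup>2)"
      by (intro AE_I2) simp
  qed measurable
qed

lemma L2T_mult_bounded:
  assumes "f \<in> L2T" and [measurable]: "g \<in> borel_measurable borel"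
    and bd: "AE z in circle_measure. cmod (g z) \<le> B"
  shows "(\<lambda>z. g z * f z) \<in> L2T"
proof (rule L2T_I)
  note [measurable] = L2T_measurable[OF assms(1)]
  show "(\<lambda>z. g z * f z) \<in> borel_measurable borel" by measurable
  show "integrable circle_measure (\<lambda>z. (cmod (g z * f z))\<^sup>2)"
  proof (rule Bochner_Integration.integrable_bound)
    show "integrable circle_measure (\<lambda>z. B\<^sup>2 * (cmod (f z))\<^sup>2)"
      by (intro integrable_mult_right L2T_integrable_square assms)
    show "AE z in circle_measure. norm ((cmod (g z * f z))\<^sup>2) \<le> norm (B\<^sup>2 * (cmod (f z))\<^sup>2)"
      using bd
    proof eventually_elim
      case (elim z)
      hence "(cmod (g z))\<^sup>2 \<le> B\<^sup>2" by (intro power_mono) auto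
      thus ?case by (auto simp: norm_mult power_mult_distrib intro: mult_right_mono)
    qed
  qed measurable
qed

lemma L2T_scale [intro]: "f \<in> L2T \<Longrightarrow> (\<lambda>z. c * f z) \<in> L2T"
  by (rule L2T_mult_bounded[where B = "cmod c"]) auto

lemma L2T_diff [intro]: "f \<in> L2T \<Longrightarrow> g \<in> L2T \<Longrightarrow> (\<lambda>z. f z - g z) \<in> L2T"
  using L2T_add[OF _ L2T_scale[of g "-1"], of f] by simp

lemma L2T_bounded:
  assumes "g \<in> borel_measurable borel" "AE z in circle_measure. cmod (g z) \<le> B"
  shows "g \<in> L2T"
proof -
  have "(\<lambda>z. 1) \<in> L2T" by (rule L2T_I) auto
  from L2T_mult_bounded[OF this assms] show ?thesis by simp
qed

lemma L2T_const [intro, simp]: "(\<lambda>z. c) \<in> L2T"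
  by (rule L2T_bounded[where B = "cmod c"]) auto

lemma L2T_powi [intro, simp]: "(\<lambda>z. z powi n) \<in> L2T"
  by (rule L2T_bounded[where B = 1]) (use AE_circle_powi[of n] in auto)

lemma L2T_powi_mult: "f \<in> L2T \<Longrightarrow> (\<lambda>z. z powi n * f z) \<in> L2T"
  by (rule L2T_mult_bounded[where B = 1]) (use AE_circle_powi[of n] in auto)

lemma integrable_l2_inner:
  assumes "f \<in> L2T" "g \<in> L2T"
  shows "integrable circle_measure (\<lambda>z. f z * cnj (g z))"
proof (rule Bochner_Integration.integrable_bound)
  note [measurable] = L2T_measurable[OF assms(1)] L2T_measurable[OF assms(2)]
  show "(\<lambda>z. f z * cnj (g z)) \<in> borel_measurable circle_measure" by measurable
  show "integrable circle_measure (\<lambda>z. (cmod (f z))\<^sup>2 + (cmod (g z))\<^sup>2)"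
    by (intro Bochner_Integration.integrable_add L2T_integrable_square assms)
  have "x * y \<le> x\<^sup>2 + y\<^sup>2" if "x \<ge> 0" "y \<ge> 0" for x y :: real
    using zero_le_power2[of "x - y"] mult_nonneg_nonneg[OF that] by (simp add: power2_diff)
  thus "AE z in circle_measure. norm (f z * cnj (g z)) \<le> norm ((cmod (f z))\<^sup>2 + (cmod (g z))\<^sup>2)"
    by (intro AE_I2) (simp add: norm_mult)
qed

lemma L2T_integrable: "f \<in> L2T \<Longrightarrow> integrable circle_measure f"
  using integrable_l2_inner[of f "\<lambda>_. 1"] by simp

lemma l2_inner_cong_AE:
  assumes "AE z in circle_measure. f z * cnj (g z) = f' z * cnj (g' z)"
    and [measurable]: "f \<in> borel_measurable borel" "g \<in> borel_measurable borel"
      "f' \<in> borel_measurable borel" "g' \<in> borel_measurable borel"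
  shows "l2_inner f g = l2_inner f' g'"
  unfolding l2_inner_def by (rule integral_cong_AE) (use assms(1) in auto)

lemma l2_inner_commute: "l2_inner g f = cnj (l2_inner f g)"
  unfolding l2_inner_def by (subst Bochner_Integration.integral_cnj[symmetric]) (simp add: mult.commute)

lemma l2_inner_diff_left:
  "f \<in> L2T \<Longrightarrow> g \<in> L2T \<Longrightarrow> h \<in> L2T \<Longrightarrow>
    l2_inner (\<lambda>z. f z - g z) h = l2_inner f h - l2_inner g h"
  unfolding l2_inner_def left_diff_distrib
  by (intro Bochner_Integration.integral_diff integrable_l2_inner)

lemma l2_inner_add_left:
  "f \<in> L2T \<Longrightarrow> g \<in> L2T \<Longrightarrow> h \<in> L2T \<Longrightarrow>
    l2_inner (\<lambda>z. f z + g z) h = l2_inner f h + l2_inner g h"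
  unfolding l2_inner_def distrib_right
  by (intro Bochner_Integration.integral_add integrable_l2_inner)

lemma l2_inner_scale_left: "l2_inner (\<lambda>z. c * f z) h = c * l2_inner f h"
  unfolding l2_inner_def by (simp add: mult.assoc)

lemma l2_inner_self: "l2_inner f f = complex_of_real ((l2_norm f)\<^sup>2)"
proof -
  have "l2_inner f f = (\<integral>z. complex_of_real ((cmod (f z))\<^sup>2) \<partial>circle_measure)"
    unfolding l2_inner_def
    by (intro Bochner_Integration.integral_cong refl) (metis complex_norm_square)
  thus ?thesis
    unfolding l2_norm_def by (simp add: integral_complex_of_real del: of_real_power)
qed

lemma l2_norm_nonneg [simp]: "l2_norm f \<ge> 0"
  by (simp add: l2_norm_def)

lemma l2_norm_square: "(l2_norm f)\<^sup>2 = (\<integral>z. (cmod (f z))\<^sup>2 \<partial>circle_measure)"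
  by (simp add: l2_norm_def)

lemma l2_norm_eq_0_imp_AE:
  assumes "f \<in> L2T" "l2_norm f = 0"
  shows "AE z in circle_measure. f z = 0"
proof -
  have "(\<integral>z. (cmod (f z))\<^sup>2 \<partial>circle_measure) = 0"
    using assms(2) l2_norm_square[of f] by simp
  hence "AE z in circle_measure. (cmod (f z))\<^sup>2 = 0"
    by (subst (asm) integral_nonneg_eq_0_iff_AE) (use L2T_integrable_square[OF assms(1)] in auto)
  thus ?thesis by simp
qed

lemma l2_norm_scale: "l2_norm (\<lambda>z. c * f z) = cmod c * l2_norm f"
  by (simp add: l2_norm_def norm_mult power_mult_distrib real_sqrt_mult)

lemma l2_norm_minus_commute: "l2_norm (\<lambda>z. f z - g z) = l2_norm (\<lambda>z. g z - f z)"
  by (simp add: l2_norm_def norm_minus_commute)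

lemma l2_norm_square_diff_scale:
  assumes "f \<in> L2T" "g \<in> L2T"
  shows "(l2_norm (\<lambda>z. f z - c * g z))\<^sup>2 =
           (l2_norm f)\<^sup>2 - 2 * Re (cnj c * l2_inner f g) + (cmod c)\<^sup>2 * (l2_norm g)\<^sup>2"
proof -
  have int: "integrable circle_measure (\<lambda>z. (cmod (f z))\<^sup>2)"
    "integrable circle_measure (\<lambda>z. (cmod c)\<^sup>2 * (cmod (g z))\<^sup>2)"
    "integrable circle_measure (\<lambda>z. 2 * Re (cnj c * (f z * cnj (g z))))"
    by (intro integrable_mult_right integrable_Re L2T_integrable_square integrable_l2_inner assms)+
  have *: "(cmod (a - c * b))\<^sup>2 = (cmod a)\<^sup>2 - 2 * Re (cnj c * (a * cnj b)) + (cmod c)\<^sup>2 * (cmod b)\<^sup>2" for a b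
    unfolding cmod_power2 by (simp add: algebra_simps power2_eq_square)
  have "(l2_norm (\<lambda>z. f z - c * g z))\<^sup>2 =
     (\<integral>z. (cmod (f z))\<^sup>2 - 2 * Re (cnj c * (f z * cnj (g z))) + (cmod c)\<^sup>2 * (cmod (g z))\<^sup>2 \<partial>circle_measure)"
    unfolding l2_norm_square * ..
  also have "\<dots> = (\<integral>z. (cmod (f z))\<^sup>2 \<partial>circle_measure) - (\<integral>z. 2 * Re (cnj c * (f z * cnj (g z))) \<partial>circle_measure)
     + (\<integral>z. (cmod c)\<^sup>2 * (cmod (g z))\<^sup>2 \<partial>circle_measure)"
    by (simp only: Bochner_Integration.integral_add Bochner_Integration.integral_diff
          Bochner_Integration.integrable_diff int)
  also have "(\<integral>z. 2 * Re (cnj c * (f z * cnj (g z))) \<partial>circle_measure) = 2 * Re (cnj c * l2_inner f g)"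
    unfolding l2_inner_def
    by (subst integral_mult_right_zero, subst integral_Re)
       (auto intro!: integrable_mult_right integrable_l2_inner assms)
  finally show ?thesis by (simp add: l2_norm_square)
qed

lemma l2_parallelogram:
  assumes "f \<in> L2T" "g \<in> L2T"
  shows "(l2_norm (\<lambda>z. f z - g z))\<^sup>2 + (l2_norm (\<lambda>z. f z + g z))\<^sup>2 = 2 * (l2_norm f)\<^sup>2 + 2 * (l2_norm g)\<^sup>2"
  using l2_norm_square_diff_scale[OF assms, of 1] l2_norm_square_diff_scale[OF assms, of "-1"] by simp

text \<open>
  The form in which both the Cauchy--Schwarz inequality and the orthogonality of the minimal-distance
  residual arise. For \<open>a = \<langle>f, g\<rangle>\<close> the quadratic polynomial is \<open>\<parallel>f - t a g\<parallel>\<^sup>2\<close> with \<open>A = \<parallel>f\<parallel>\<^sup>2\<close>,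
  \<open>B = \<parallel>g\<parallel>\<^sup>2\<close> and \<open>p = |a|\<^sup>2\<close>; the choice \<open>A = 0\<close> describes a residual that \<open>g\<close> cannot shorten.
\<close>

lemma discriminant_bound:
  fixes p A B :: real
  assumes "\<And>t. 0 \<le> A - 2 * t * p + t\<^sup>2 * (p * B)" "0 \<le> p" "0 \<le> A" "0 \<le> B"
  shows "p \<le> A * B"
proof (cases "B = 0 \<or> p = 0")
  case True
  thus ?thesis
  proof
    assume B: "B = 0"
    have "p = 0"
    proof (rule ccontr)
      assume "p \<noteq> 0"
      with assms(1)[of "(A + 1) / (2 * p)"] B show False by simp
    qed
    thus ?thesis using assms by simp
  qed (use assms in simp)
next
  case False
  hence B: "B > 0" using assms by auto
  have "0 \<le> (A - 2 * (1 / B) * p + (1 / B)\<^sup>2 * (p * B)) * B"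
    using assms(1)[of "1 / B"] B by simp
  also have "\<dots> = A * B - p"
    using B by (simp add: field_simps power2_eq_square)
  finally show ?thesis by simp
qed

lemma l2_Cauchy_Schwarz:
  assumes "f \<in> L2T" "g \<in> L2T"
  shows "cmod (l2_inner f g) \<le> l2_norm f * l2_norm g"
proof -
  define a where "a = l2_inner f g"
  have "(cmod a)\<^sup>2 \<le> (l2_norm f)\<^sup>2 * (l2_norm g)\<^sup>2"
  proof (rule discriminant_bound)
    fix t :: real
    have "Re (cnj (of_real t * a) * a) = t * (cmod a)\<^sup>2"
      unfolding cmod_power2 by (simp add: power2_eq_square algebra_simps)
    moreover have "0 \<le> (l2_norm (\<lambda>z. f z - of_real t * a * g z))\<^sup>2" by simp
    ultimately show "0 \<le> (l2_norm f)\<^sup>2 - 2 * t * (cmod a)\<^sup>2 + t\<^sup>2 * ((cmod a)\<^sup>2 * (l2_norm g)\<^sup>2)"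
      unfolding l2_norm_square_diff_scale[OF assms]
      by (simp add: a_def norm_mult power_mult_distrib algebra_simps)
  qed auto
  hence "(cmod a)\<^sup>2 \<le> (l2_norm f * l2_norm g)\<^sup>2" by (simp add: power_mult_distrib)
  thus ?thesis unfolding a_def by (rule power2_le_imp_le) simp
qed

lemma l2_norm_triangle_diff:
  assumes "f \<in> L2T" "g \<in> L2T"
  shows "l2_norm (\<lambda>z. f z - g z) \<le> l2_norm f + l2_norm g"
proof (rule power2_le_imp_le)
  have "\<bar>Re (l2_inner f g)\<bar> \<le> l2_norm f * l2_norm g"
    using l2_Cauchy_Schwarz[OF assms] abs_Re_le_cmod order_trans by blast
  thus "(l2_norm (\<lambda>z. f z - g z))\<^sup>2 \<le> (l2_norm f + l2_norm g)\<^sup>2"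
    using l2_norm_square_diff_scale[OF assms, of 1] by (simp add: power2_sum)
qed simp

text \<open>
  Apply Cauchy--Schwarz to \<open>|f|\<close> and \<open>1\<close>; the circle has total mass \<open>1\<close>.
\<close>

lemma integral_cmod_le_l2_norm:
  assumes "f \<in> L2T"
  shows "(\<integral>z. cmod (f z) \<partial>circle_measure) \<le> l2_norm f"
proof -
  define h where "h = (\<lambda>z. complex_of_real (cmod (f z)))"
  note [measurable] = L2T_measurable[OF assms]
  have "h \<in> L2T"
    unfolding h_def by (rule L2T_I) (use L2T_integrable_square[OF assms] in auto)
  from l2_Cauchy_Schwarz[OF this, of "\<lambda>_. 1"]
  have "cmod (\<integral>z. h z \<partial>circle_measure) \<le> l2_norm f"
    by (simp add: l2_inner_def l2_norm_def h_def)
  moreover have "cmod (\<integral>z. h z \<partial>circle_measure) = (\<integral>z. cmod (f z) \<partial>circle_measure)"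
    unfolding h_def by (subst integral_complex_of_real) (simp add: integral_nonneg_AE)
  ultimately show ?thesis by simp
qed

section \<open>Completeness and orthogonal projection\<close>

text \<open>
  A sequence that is Cauchy in \<open>L\<^sup>2\<close> is Cauchy in \<open>L\<^sup>1\<close>, hence has a subsequence converging almost
  everywhere. Fatou's lemma along this subsequence bounds the \<open>L\<^sup>2\<close> distance from the limit by the Cauchy
  bound.
\<close>

lemma L2T_complete:
  assumes F: "\<And>n. F n \<in> L2T"
    and Cau: "\<And>e. e > 0 \<Longrightarrow> \<exists>N. \<forall>i\<ge>N. \<forall>j\<ge>N. l2_norm (\<lambda>z. F i z - F j z) < e"
  obtains g where "g \<in> L2T" "(\<lambda>n::nat. l2_norm (\<lambda>z. F n z - g z)) \<longlonglongrightarrow> 0"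
proof -
  note [measurable] = L2T_measurable[OF F]
  have "\<exists>N. \<forall>i\<ge>N. \<forall>j\<ge>N. (\<integral>z. norm (F i z - F j z) \<partial>circle_measure) < e" if "e > 0" for e
    using Cau[OF that] integral_cmod_le_l2_norm[OF L2T_diff[OF F F]] order_le_less_trans by meson
  from cauchy_L1_AE_cauchy_subseq[OF L2T_integrable[OF F] this]
  obtain r where r: "strict_mono r" "AE z in circle_measure. Cauchy (\<lambda>i. F (r i) z)" by blast
  define g where "g = (\<lambda>z. lim (\<lambda>i. F (r i) z))"
  have [measurable]: "g \<in> borel_measurable borel" unfolding g_def by measurable
  have conv: "AE z in circle_measure. (\<lambda>i. F (r i) z) \<longlonglongrightarrow> g z"
    using r(2) by eventually_elim (simp add: g_def Cauchy_convergent_iff convergent_LIMSEQ_iff)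
  have bound: "\<exists>N. \<forall>i\<ge>N. (\<lambda>z. F i z - g z) \<in> L2T \<and> l2_norm (\<lambda>z. F i z - g z) \<le> e" if e: "e > 0" for e
  proof -
    from Cau[OF e] obtain N where N: "\<And>i j. i \<ge> N \<Longrightarrow> j \<ge> N \<Longrightarrow> l2_norm (\<lambda>z. F i z - F j z) < e" by blast
    have "(\<lambda>z. F i z - g z) \<in> L2T \<and> l2_norm (\<lambda>z. F i z - g z) \<le> e" if i: "i \<ge> N" for i
    proof -
      have *: "(\<integral>\<^sup>+z. ennreal ((cmod (F i z - F j z))\<^sup>2) \<partial>circle_measure) \<le> ennreal (e\<^sup>2)" if "j \<ge> N" for j
      proof -
        have "(\<integral>\<^sup>+z. ennreal ((cmod (F i z - F j z))\<^sup>2) \<partial>circle_measure) = ennreal ((l2_norm (\<lambda>z. F i z - F j z))\<^sup>2)"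
          unfolding l2_norm_square
          by (rule nn_integral_eq_integral) (use L2T_integrable_square[OF L2T_diff[OF F F]] in auto)
        also have "\<dots> \<le> ennreal (e\<^sup>2)"
          using N[OF i that] by (intro ennreal_leI power_mono) auto
        finally show ?thesis .
      qed
      have "(\<integral>\<^sup>+z. ennreal ((cmod (F i z - g z))\<^sup>2) \<partial>circle_measure) =
            (\<integral>\<^sup>+z. liminf (\<lambda>k. ennreal ((cmod (F i z - F (r k) z))\<^sup>2)) \<partial>circle_measure)"
      proof (rule nn_integral_cong_AE, use conv in eventually_elim)
        case (elim z)
        have "(\<lambda>k. ennreal ((cmod (F i z - F (r k) z))\<^sup>2)) \<longlonglongrightarrow> ennreal ((cmod (F i z - g z))\<^sup>2)"
          by (intro tendsto_intros tendsto_ennrealI elim)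
        thus ?case by (intro lim_imp_Liminf[symmetric]) simp_all
      qed
      also have "\<dots> \<le> liminf (\<lambda>k. \<integral>\<^sup>+z. ennreal ((cmod (F i z - F (r k) z))\<^sup>2) \<partial>circle_measure)"
        by (rule nn_integral_liminf) measurable
      also have "\<dots> \<le> ennreal (e\<^sup>2)"
      proof (rule Liminf_le)
        show "eventually (\<lambda>k. (\<integral>\<^sup>+z. ennreal ((cmod (F i z - F (r k) z))\<^sup>2) \<partial>circle_measure) \<le> ennreal (e\<^sup>2)) sequentially"
          using eventually_ge_at_top[of N]
          by eventually_elim (use * seq_suble[OF r(1)] order_trans in blast)
      qed simp
      finally have le: "(\<integral>\<^sup>+z. ennreal ((cmod (F i z - g z))\<^sup>2) \<partial>circle_measure) \<le> ennreal (e\<^sup>2)" .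
      have int: "integrable circle_measure (\<lambda>z. (cmod (F i z - g z))\<^sup>2)"
        by (rule integrableI_bounded) (use le in \<open>auto simp: order_le_less_trans\<close>)
      hence "ennreal ((l2_norm (\<lambda>z. F i z - g z))\<^sup>2) \<le> ennreal (e\<^sup>2)"
        unfolding l2_norm_square using le by (subst (asm) nn_integral_eq_integral) auto
      hence "(l2_norm (\<lambda>z. F i z - g z))\<^sup>2 \<le> e\<^sup>2" by simp
      thus ?thesis using int e by (auto intro!: L2T_I dest: power2_le_imp_le)
    qed
    thus ?thesis by blast
  qed
  show ?thesis
  proof
    obtain i where "(\<lambda>z. F i z - g z) \<in> L2T" using bound[of 1] by auto
    from L2T_diff[OF F[of i] this] show "g \<in> L2T" by simp
    show "(\<lambda>n. l2_norm (\<lambda>z. F n z - g z)) \<longlonglongrightarrow> 0"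
    proof (rule LIMSEQ_I)
      fix e :: real assume "e > 0"
      with bound[of "e / 2"] show "\<exists>N. \<forall>n\<ge>N. norm (l2_norm (\<lambda>z. F n z - g z) - 0) < e"
        by fastforce
    qed
  qed
qed

text \<open>
  A minimizing sequence for the distance from \<open>f\<close> to \<open>V\<close> is Cauchy by the parallelogram law, because
  midpoints stay in \<open>V\<close>. Its limit attains the distance, and so the residual is orthogonal to \<open>V\<close>.
\<close>

lemma l2_projection_exists:
  assumes V: "V \<subseteq> L2T" "V \<noteq> {}"
    and add: "\<And>h k. h \<in> V \<Longrightarrow> k \<in> V \<Longrightarrow> (\<lambda>z. h z + k z) \<in> V"
    and scale: "\<And>c h. h \<in> V \<Longrightarrow> (\<lambda>z. c * h z) \<in> V"
    and closed: "\<And>F g. (\<And>n. F n \<in> V) \<Longrightarrow> g \<in> L2T \<Longrightarrow>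
                   (\<lambda>n::nat. l2_norm (\<lambda>z. F n z - g z)) \<longlonglongrightarrow> 0 \<Longrightarrow> g \<in> V"
    and f: "f \<in> L2T"
  shows "\<exists>g\<in>V. \<forall>h\<in>V. l2_inner (\<lambda>z. f z - g z) h = 0"
proof -
  define D where "D = (\<lambda>h. (l2_norm (\<lambda>z. f z - h z))\<^sup>2) ` V"
  define d where "d = Inf D"
  have bdd: "bdd_below D" unfolding D_def by (rule bdd_belowI[where m = 0]) auto
  have D: "D \<noteq> {}" using V by (auto simp: D_def)
  have d_le: "d \<le> (l2_norm (\<lambda>z. f z - h z))\<^sup>2" if "h \<in> V" for h
    unfolding d_def by (rule cInf_lower[OF _ bdd]) (use that in \<open>auto simp: D_def\<close>)
  have d0: "d \<ge> 0" unfolding d_def by (rule cInf_greatest[OF D]) (auto simp: D_def)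
  have "\<exists>h\<in>V. (l2_norm (\<lambda>z. f z - h z))\<^sup>2 < d + 1 / real (Suc n)" for n
    using cInf_lessD[OF D, of "d + 1 / real (Suc n)"] by (auto simp: d_def D_def)
  then obtain F where F: "\<And>n. F n \<in> V" "\<And>n. (l2_norm (\<lambda>z. f z - F n z))\<^sup>2 < d + 1 / real (Suc n)"
    by metis
  have L: "h \<in> L2T" if "h \<in> V" for h using that V by blast
  have close: "(l2_norm (\<lambda>z. F i z - F j z))\<^sup>2 \<le> 2 / real (Suc i) + 2 / real (Suc j)" for i j
  proof -
    \<comment> \<open>the midpoint of two near-minimizers is no closer than the infimum\<close>
    define m where "m = (\<lambda>z. (1/2) * (F i z + F j z))"
    have m: "m \<in> V" unfolding m_def using F add scale by blast
    have "(l2_norm (\<lambda>z. (f z - F j z) - (f z - F i z)))\<^sup>2 + (l2_norm (\<lambda>z. (f z - F j z) + (f z - F i z)))\<^sup>2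
       = 2 * (l2_norm (\<lambda>z. f z - F j z))\<^sup>2 + 2 * (l2_norm (\<lambda>z. f z - F i z))\<^sup>2"
      by (rule l2_parallelogram) (auto intro: L F f)
    moreover have "(\<lambda>z. (f z - F j z) + (f z - F i z)) = (\<lambda>z. 2 * (f z - m z))"
      by (auto simp: m_def algebra_simps)
    hence "l2_norm (\<lambda>z. (f z - F j z) + (f z - F i z)) = 2 * l2_norm (\<lambda>z. f z - m z)"
      by (simp only: l2_norm_scale) simp
    ultimately have "(l2_norm (\<lambda>z. F i z - F j z))\<^sup>2 + 4 * (l2_norm (\<lambda>z. f z - m z))\<^sup>2
       = 2 * (l2_norm (\<lambda>z. f z - F j z))\<^sup>2 + 2 * (l2_norm (\<lambda>z. f z - F i z))\<^sup>2"
      by (simp add: l2_norm_scale power_mult_distrib)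
    with d_le[OF m] F(2)[of i] F(2)[of j] show ?thesis by simp
  qed
  have "\<exists>N. \<forall>i\<ge>N. \<forall>j\<ge>N. l2_norm (\<lambda>z. F i z - F j z) < e" if "e > 0" for e :: real
  proof -
    obtain N where N: "inverse (real (Suc N)) < e\<^sup>2 / 4"
      using reals_Archimedean[of "e\<^sup>2 / 4"] \<open>e > 0\<close> by auto
    have "l2_norm (\<lambda>z. F i z - F j z) < e" if "i \<ge> N" "j \<ge> N" for i j
    proof -
      have "1 / real (Suc i) \<le> 1 / real (Suc N)" "1 / real (Suc j) \<le> 1 / real (Suc N)"
        using that by (auto simp: frac_le)
      hence "(l2_norm (\<lambda>z. F i z - F j z))\<^sup>2 < e\<^sup>2"
        using close[of i j] N by (simp add: inverse_eq_divide)
      thus ?thesis using \<open>e > 0\<close> by (simp add: power_less_imp_less_base)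
    qed
    thus ?thesis by blast
  qed
  from L2T_complete[OF L[OF F(1)] this]
  obtain g where g: "g \<in> L2T" "(\<lambda>n. l2_norm (\<lambda>z. F n z - g z)) \<longlonglongrightarrow> 0" by blast
  have gV: "g \<in> V" by (rule closed[OF F(1) g])
  have "l2_norm (\<lambda>z. f z - g z) \<le> sqrt d"
  proof (rule LIMSEQ_le_const)
    show "(\<lambda>n. sqrt (d + 1 / real (Suc n)) + l2_norm (\<lambda>z. F n z - g z)) \<longlonglongrightarrow> sqrt d"
    proof -
      have "(\<lambda>n. 1 / real (Suc n)) \<longlonglongrightarrow> 0"
        using LIMSEQ_inverse_real_of_nat by (simp add: inverse_eq_divide)
      from tendsto_add[OF tendsto_real_sqrt[OF tendsto_add[OF tendsto_const[of d] this]] g(2)]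
      show ?thesis by simp
    qed
    have "l2_norm (\<lambda>z. f z - g z) \<le> sqrt (d + 1 / real (Suc n)) + l2_norm (\<lambda>z. F n z - g z)" for n
    proof -
      have "l2_norm (\<lambda>z. (f z - F n z) - (g z - F n z)) \<le> l2_norm (\<lambda>z. f z - F n z) + l2_norm (\<lambda>z. g z - F n z)"
        by (rule l2_norm_triangle_diff) (auto intro: L F f g)
      moreover have "l2_norm (\<lambda>z. f z - F n z) \<le> sqrt (d + 1 / real (Suc n))"
        using F(2)[of n] by (intro real_le_rsqrt) simp
      ultimately show ?thesis by (simp add: l2_norm_minus_commute[of g])
    qed
    thus "\<exists>N. \<forall>n\<ge>N. l2_norm (\<lambda>z. f z - g z) \<le> sqrt (d + 1 / real (Suc n)) + l2_norm (\<lambda>z. F n z - g z)"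
      by blast
  qed
  hence "(l2_norm (\<lambda>z. f z - g z))\<^sup>2 \<le> (sqrt d)\<^sup>2" by (intro power_mono) auto
  hence min: "(l2_norm (\<lambda>z. f z - g z))\<^sup>2 \<le> d" using d0 by simp
  have "l2_inner (\<lambda>z. f z - g z) h = 0" if h: "h \<in> V" for h
  proof -
    define a where "a = l2_inner (\<lambda>z. f z - g z) h"
    have "(cmod a)\<^sup>2 \<le> 0 * (l2_norm h)\<^sup>2"
    proof (rule discriminant_bound)
      fix t :: real
      have "(\<lambda>z. g z + of_real t * a * h z) \<in> V" using add scale gV h by blast
      from d_le[OF this] have "(l2_norm (\<lambda>z. f z - g z))\<^sup>2 \<le> (l2_norm (\<lambda>z. (f z - g z) - of_real t * a * h z))\<^sup>2"
        unfolding diff_diff_eq using min by linarith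
      moreover have "Re (cnj (of_real t * a) * a) = t * (cmod a)\<^sup>2"
        unfolding cmod_power2 by (simp add: power2_eq_square algebra_simps)
      ultimately show "0 \<le> 0 - 2 * t * (cmod a)\<^sup>2 + t\<^sup>2 * ((cmod a)\<^sup>2 * (l2_norm h)\<^sup>2)"
        by (subst (asm) l2_norm_square_diff_scale)
           (auto simp: a_def norm_mult power_mult_distrib algebra_simps intro: L f g h)
    qed auto
    thus ?thesis by (simp add: a_def)
  qed
  thus ?thesis using gV by blast
qed

section \<open>Fourier coefficients and the Hardy space\<close>

text \<open>
  The closed interval is used so that the fundamental theorem of calculus applies; its right endpoint
  is a null set.
\<close>

lemma circle_integral_eq:
  fixes f :: "complex \<Rightarrow> complex"
  assumes [measurable]: "f \<in> borel_measurable borel"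
  shows "(\<integral>z. f z \<partial>circle_measure) = (1 / (2 * pi)) *\<^sub>R (\<integral>t. indicator {0..2*pi} t *\<^sub>R f (cis t) \<partial>lborel)"
proof -
  have "uniform_measure lborel {0..<2*pi} = density lborel (\<lambda>x. ennreal (indicator {0..<2*pi} x / (2*pi)))"
    unfolding uniform_measure_def
    by (intro arg_cong2[where f = density] refl ext)
       (simp add: indicator_def divide_ennreal flip: ennreal_1)
  hence "(\<integral>z. f z \<partial>circle_measure) = (\<integral>t. (indicator {0..<2*pi} t / (2*pi)) *\<^sub>R f (cis t) \<partial>lborel)"
    unfolding circle_measure_def by (simp add: integral_distr integral_density)
  also have "\<dots> = (\<integral>t. (1 / (2*pi)) *\<^sub>R (indicator {0..2*pi} t *\<^sub>R f (cis t)) \<partial>lborel)"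
  proof (intro integral_cong_AE)
    show "AE t in lborel. (indicator {0..<2*pi} t / (2*pi)) *\<^sub>R f (cis t) =
            (1 / (2*pi)) *\<^sub>R (indicator {0..2*pi} t *\<^sub>R f (cis t))"
      using AE_lborel_singleton[of "2*pi"] by eventually_elim (auto simp: indicator_def)
  qed measurable
  finally show ?thesis by (simp only: integral_scaleR_right)
qed

lemma cnj_powi_unit: "cmod z = 1 \<Longrightarrow> cnj z powi n = z powi (- n)"
proof -
  assume "cmod z = 1"
  hence "z * cnj z = 1" by (simp add: complex_norm_square[symmetric])
  hence "cnj z = inverse z" by (metis inverse_unique)
  thus ?thesis by (simp add: power_int_minus power_int_inverse)
qed

lemma integral_powi_circle:
  "(\<integral>z. z powi n \<partial>circle_measure) = (if n = 0 then 1 else 0)"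
proof (cases "n = 0")
  case False
  define G where "G = (\<lambda>t::complex. exp (\<i> * of_int n * t) / (\<i> * of_int n))"
  have "(\<integral>t. indicator {0..2*pi} t *\<^sub>R cis (of_int n * t) \<partial>lborel) =
      G (of_real (2 * pi)) - G (of_real 0)"
  proof (rule integral_FTC_Icc)
    fix t :: real
    have "(G has_field_derivative cis (of_int n * t)) (at (of_real t))"
      unfolding G_def using False
      by (auto intro!: derivative_eq_intros simp: cis_conv_exp mult_ac)
    thus "((\<lambda>t. G (of_real t)) has_vector_derivative cis (of_int n * t)) (at t within {0..2*pi})"
      by (intro has_vector_derivative_real_field) (auto intro: DERIV_subset)
  qed (auto intro!: continuous_intros)
  also have "G (of_real (2 * pi)) = G (of_real 0)"
    unfolding G_def by (auto simp: exp_eq_1 intro!: arg_cong2[where f = "(/)"] exI[of _ n])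
  finally show ?thesis
    using False by (simp add: circle_integral_eq cis_power_int mult.commute)
qed simp

lemma l2_inner_powi_mult:
  assumes "f \<in> L2T" "g \<in> L2T"
  shows "l2_inner (\<lambda>z. z powi k * f z) g = l2_inner f (\<lambda>z. z powi (- k) * g z)"
proof (rule l2_inner_cong_AE)
  show "AE z in circle_measure. z powi k * f z * cnj (g z) = f z * cnj (z powi (- k) * g z)"
    using AE_circle_cmod by eventually_elim (simp add: cnj_powi_unit mult_ac)
qed (use assms[THEN L2T_measurable] in measurable)

lemma fourier_coeff_powi_mult:
  assumes "f \<in> L2T"
  shows "fourier_coeff (\<lambda>z. z powi k * f z) n = fourier_coeff f (n - k)"
  unfolding fourier_coeff_def
proof (rule l2_inner_cong_AE)
  show "AE z in circle_measure. z powi k * f z * cnj (z powi n) = f z * cnj (z powi (n - k))"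
    using AE_circle_cmod
  proof eventually_elim
    case (elim z)
    hence "z \<noteq> 0" by auto
    hence "z powi (k - n) = z powi k * z powi (- n)" by (simp flip: power_int_add)
    thus ?case using elim by (simp add: cnj_powi_unit mult_ac)
  qed
qed (use assms[THEN L2T_measurable] in measurable)

lemma fourier_coeff_1: "fourier_coeff (\<lambda>z. 1) n = (if n = 0 then 1 else 0)"
proof -
  have "fourier_coeff (\<lambda>z. 1) n = l2_inner (\<lambda>z. z powi (- n)) (\<lambda>z. 1)"
    unfolding fourier_coeff_def
  proof (rule l2_inner_cong_AE)
    show "AE z in circle_measure. 1 * cnj (z powi n) = z powi (- n) * cnj 1"
      using AE_circle_cmod by eventually_elim (simp add: cnj_powi_unit)
  qed measurable
  thus ?thesis by (simp add: l2_inner_def integral_powi_circle)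
qed

lemma fourier_coeff_add:
  "f \<in> L2T \<Longrightarrow> g \<in> L2T \<Longrightarrow> fourier_coeff (\<lambda>z. f z + g z) n = fourier_coeff f n + fourier_coeff g n"
  unfolding fourier_coeff_def by (rule l2_inner_add_left) auto

lemma fourier_coeff_diff:
  "f \<in> L2T \<Longrightarrow> g \<in> L2T \<Longrightarrow> fourier_coeff (\<lambda>z. f z - g z) n = fourier_coeff f n - fourier_coeff g n"
  unfolding fourier_coeff_def by (rule l2_inner_diff_left) auto

lemma fourier_coeff_scale: "fourier_coeff (\<lambda>z. c * f z) n = c * fourier_coeff f n"
  unfolding fourier_coeff_def by (rule l2_inner_scale_left)

lemma fourier_coeff_const: "fourier_coeff (\<lambda>z. c) n = (if n = 0 then c else 0)"
  using fourier_coeff_scale[of c "\<lambda>z. 1" n] by (simp add: fourier_coeff_1)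

lemma l2_norm_powi: "l2_norm (\<lambda>z. z powi n) = 1"
proof -
  have "(\<integral>z. (cmod (z powi n))\<^sup>2 \<partial>circle_measure) = (\<integral>z. 1 \<partial>circle_measure)"
    by (rule integral_cong_AE) (use AE_circle_powi[of n] in auto)
  thus ?thesis by (simp add: l2_norm_def)
qed

lemma H2_L2T: "f \<in> H2 \<Longrightarrow> f \<in> L2T"
  by (simp add: H2_def)

lemma H2_add: "f \<in> H2 \<Longrightarrow> g \<in> H2 \<Longrightarrow> (\<lambda>z. f z + g z) \<in> H2"
  by (auto simp: H2_def fourier_coeff_add)

lemma H2_scale: "f \<in> H2 \<Longrightarrow> (\<lambda>z. c * f z) \<in> H2"
  by (auto simp: H2_def fourier_coeff_scale)

lemma H2_const [simp]: "(\<lambda>z. c) \<in> H2"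
  by (simp add: H2_def fourier_coeff_const)

lemma H2_powi_mult:
  assumes "f \<in> H2" "k \<ge> 0"
  shows "(\<lambda>z. z powi k * f z) \<in> H2"
  using assms by (auto simp: H2_def fourier_coeff_powi_mult L2T_powi_mult)

lemma H2_powi: "k \<ge> 0 \<Longrightarrow> (\<lambda>z. z powi k) \<in> H2"
  using H2_powi_mult[of "\<lambda>_. 1" k] by simp

lemma H2_cong_AE:
  assumes "f \<in> H2" "g \<in> L2T" "AE z in circle_measure. g z = f z"
  shows "g \<in> H2"
proof -
  have "fourier_coeff g n = fourier_coeff f n" for n
    unfolding fourier_coeff_def
    by (rule l2_inner_cong_AE) (use assms H2_L2T[OF assms(1)] in \<open>auto dest: L2T_measurable\<close>)
  thus ?thesis using assms by (simp add: H2_def)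
qed

text \<open>
  Fourier coefficients are continuous in the \<open>L\<^sup>2\<close> norm.
\<close>

lemma H2_closed:
  assumes F: "\<And>n. F n \<in> H2" and g: "g \<in> L2T"
    and lim: "(\<lambda>n::nat. l2_norm (\<lambda>z. F n z - g z)) \<longlonglongrightarrow> 0"
  shows "g \<in> H2"
proof -
  have "fourier_coeff g k = 0" if "k < 0" for k
  proof -
    have "cmod (fourier_coeff g k) \<le> l2_norm (\<lambda>z. F n z - g z)" for n
    proof -
      have "fourier_coeff (\<lambda>z. F n z - g z) k = - fourier_coeff g k"
        using F[of n] that g by (subst fourier_coeff_diff) (auto simp: H2_def)
      hence "cmod (fourier_coeff g k) = cmod (l2_inner (\<lambda>z. F n z - g z) (\<lambda>z. z powi k))"
        by (simp add: fourier_coeff_def)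
      also have "\<dots> \<le> l2_norm (\<lambda>z. F n z - g z) * l2_norm (\<lambda>z. z powi k)"
        by (rule l2_Cauchy_Schwarz) (auto intro: H2_L2T F g)
      finally show ?thesis by (simp add: l2_norm_powi)
    qed
    hence "cmod (fourier_coeff g k) \<le> 0"
      by (intro LIMSEQ_le_const[OF lim]) auto
    thus ?thesis by simp
  qed
  thus ?thesis using g by (simp add: H2_def)
qed

lemma P_plus_projection:
  assumes "f \<in> L2T"
  shows "P_plus f \<in> H2" and "\<And>h. h \<in> H2 \<Longrightarrow> l2_inner (\<lambda>z. f z - P_plus f z) h = 0"
proof -
  have "\<exists>g\<in>H2. \<forall>h\<in>H2. l2_inner (\<lambda>z. f z - g z) h = 0"
    by (rule l2_projection_exists)
       (use assms H2_const in \<open>auto intro: H2_L2T H2_add H2_scale H2_closed simp del: H2_const\<close>)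
  hence "\<exists>g. g \<in> H2 \<and> (\<forall>h\<in>H2. l2_inner (\<lambda>z. f z - g z) h = 0)" by blast
  from someI_ex[OF this] show "P_plus f \<in> H2" "\<And>h. h \<in> H2 \<Longrightarrow> l2_inner (\<lambda>z. f z - P_plus f z) h = 0"
    unfolding P_plus_def by auto
qed

section \<open>The Hankel operator and the shift\<close>

text \<open>
  Conjugation corresponds to \<open>t \<mapsto> 2\<pi> - t\<close> in the parameter, which preserves Lebesgue measure and maps
  \<open>[0, 2\<pi>)\<close> to itself up to the endpoints.
\<close>

lemma circle_measure_cnj: "distr circle_measure circle_measure cnj = circle_measure"
proof (rule measure_eqI)
  fix A assume "A \<in> sets (distr circle_measure circle_measure cnj)"
  hence A[measurable]: "A \<in> sets borel" by (simp add: sets_circle_measure)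
  have em: "emeasure circle_measure B = emeasure lborel ({0..<2*pi} \<inter> cis -` B) / emeasure lborel {0..<2*pi}"
    if [measurable]: "B \<in> sets borel" for B
    unfolding circle_measure_def using measurable_sets_borel[OF cis_measurable that]
    by (simp add: emeasure_distr emeasure_uniform_measure)
  have [measurable]: "cis -` B \<in> sets borel" if "B \<in> sets borel" for B
    using measurable_sets_borel[OF cis_measurable that] .
  define S where "S = {0..<2*pi} \<inter> cis -` A"
  have B: "cnj -` A \<in> sets borel"
    using measurable_sets_borel[OF cnj_measurable A] .
  define S' where "S' = {0..<2*pi} \<inter> cis -` (cnj -` A)"
  have [measurable]: "S \<in> sets borel" "S' \<in> sets borel"
    unfolding S_def S'_def using B by auto
  have "emeasure lborel S = (\<integral>\<^sup>+t. indicator S t \<partial>lborel)" by simp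
  also have "\<dots> = (\<integral>\<^sup>+t. indicator S (2 * pi + (-1) * t) \<partial>lborel)"
    by (subst nn_integral_real_affine[of _ "-1" "2 * pi"]) auto
  also have "\<dots> = (\<integral>\<^sup>+t. indicator S' t \<partial>lborel)"
  proof (rule nn_integral_cong_AE)
    have eq: "cis (2 * pi - t) = cnj (cis t)" for t by (simp add: complex_eq_iff)
    show "AE t in lborel. indicator S (2 * pi + (-1) * t) = (indicator S' t :: ennreal)"
      using AE_lborel_singleton[of "2*pi"] AE_lborel_singleton[of 0]
      by eventually_elim (auto simp: indicator_def S_def S'_def eq)
  qed
  also have "\<dots> = emeasure lborel S'" by simp
  finally have "emeasure lborel S = emeasure lborel S'" .
  moreover have "emeasure (distr circle_measure circle_measure cnj) A = emeasure circle_measure (cnj -` A)"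
    by (subst emeasure_distr) (auto simp: sets_circle_measure)
  ultimately show "emeasure (distr circle_measure circle_measure cnj) A = emeasure circle_measure A"
    using em[OF A] em[OF B] by (simp add: S_def S'_def)
qed (simp add: sets_circle_measure)

lemma circle_integral_cnj:
  fixes f :: "complex \<Rightarrow> complex"
  assumes [measurable]: "f \<in> borel_measurable borel"
  shows "(\<integral>z. f (cnj z) \<partial>circle_measure) = (\<integral>z. f z \<partial>circle_measure)"
proof -
  have "(\<integral>z. f z \<partial>distr circle_measure circle_measure cnj) = (\<integral>z. f (cnj z) \<partial>circle_measure)"
    by (rule integral_distr) measurable
  thus ?thesis by (simp only: circle_measure_cnj)
qed

lemma L2T_J:
  assumes "f \<in> L2T"
  shows "J f \<in> L2T"
proof (rule L2T_I)
  note [measurable] = L2T_measurable[OF assms]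
  show "J f \<in> borel_measurable borel" unfolding J_def by measurable
  have "integrable (distr circle_measure circle_measure cnj) (\<lambda>z. (cmod (f z))\<^sup>2)"
    using L2T_integrable_square[OF assms] by (simp add: circle_measure_cnj)
  thus "integrable circle_measure (\<lambda>z. (cmod (J f z))\<^sup>2)"
    unfolding J_def by (subst (asm) integrable_distr_eq) auto
qed

lemma hilbert_symbol_bounded: "cmod (hilbert_symbol z) \<le> pi"
proof -
  have "\<bar>pi - Arg2pi z\<bar> \<le> pi"
    using Arg2pi_ge_0[of z] Arg2pi_lt_2pi[of z] by linarith
  thus ?thesis
    unfolding hilbert_symbol_def Let_def norm_mult norm_cis norm_ii norm_of_real by simp
qed

lemma L2T_hilbert_symbol_J: "f \<in> L2T \<Longrightarrow> (\<lambda>z. hilbert_symbol z * J f z) \<in> L2T"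
  by (rule L2T_mult_bounded[where B = pi])
     (auto simp: hilbert_symbol_bounded hilbert_symbol_measurable intro: L2T_J)

lemma hankel_H2: "f \<in> H2 \<Longrightarrow> hankel hilbert_symbol f \<in> H2"
  unfolding hankel_def by (intro P_plus_projection L2T_hilbert_symbol_J H2_L2T)

lemma l2_inner_hankel:
  assumes "f \<in> H2" "h \<in> H2"
  shows "l2_inner (hankel hilbert_symbol f) h = l2_inner (\<lambda>z. hilbert_symbol z * J f z) h"
proof -
  have s: "(\<lambda>z. hilbert_symbol z * J f z) \<in> L2T"
    by (intro L2T_hilbert_symbol_J H2_L2T assms)
  show ?thesis
    using P_plus_projection(2)[OF s assms(2)]
      l2_inner_diff_left[OF s H2_L2T[OF P_plus_projection(1)[OF s]] H2_L2T[OF assms(2)]]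
    by (simp add: hankel_def)
qed

text \<open>
  This is \<open>\<Gamma> g - S S\<^sup>* \<Gamma> g = \<langle>\<Gamma> g, 1\<rangle>\<close>, where the right-hand side is written out as an integral.
  The difference \<open>D\<close> of the two sides has vanishing Fourier coefficients, so both \<open>D\<close> and
  \<open>z\<^sup>-\<^sup>1 D\<close> lie in \<open>H\<^sup>2\<close>. They can therefore serve as test functions in the definitions of
  \<open>\<Gamma> g\<close> and \<open>\<Gamma> (z g)\<close>, where the symbols of both terms cancel and leave \<open>\<langle>D, D\<rangle> = 0\<close>.
\<close>

lemma hankel_shift:
  assumes g: "g \<in> H2"
  shows "AE z in circle_measure. hankel hilbert_symbol g z - z * hankel hilbert_symbol (\<lambda>z. z * g z) z
           = (\<integral>z. hilbert_symbol z * J g z \<partial>circle_measure)"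
proof -
  define s where "s = (\<lambda>z. hilbert_symbol z * J g z)"
  define s' where "s' = (\<lambda>z. hilbert_symbol z * J (\<lambda>z. z * g z) z)"
  define F where "F = hankel hilbert_symbol g"
  define F' where "F' = hankel hilbert_symbol (\<lambda>z. z * g z)"
  define c where "c = (\<integral>z. hilbert_symbol z * J g z \<partial>circle_measure)"
  define D where "D = (\<lambda>z. F z - z powi 1 * F' z - c)"
  have g': "(\<lambda>z. z * g z) \<in> H2" using H2_powi_mult[OF g, of 1] by simp
  have F: "F \<in> H2" "F' \<in> H2" unfolding F_def F'_def by (intro hankel_H2 g g')+
  have L: "s \<in> L2T" "s' \<in> L2T" "F \<in> L2T" "F' \<in> L2T" "(\<lambda>z. z powi 1 * F' z) \<in> L2T"
    "(\<lambda>z. F z - z powi 1 * F' z) \<in> L2T"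
    unfolding s_def s'_def
    by (intro L2T_diff L2T_powi_mult L2T_hilbert_symbol_J H2_L2T F g g')+
  have DL: "D \<in> L2T" unfolding D_def by (rule L2T_diff[OF L(6) L2T_const])
  note [measurable] = L[THEN L2T_measurable]
  have s's: "l2_inner s' h = l2_inner (\<lambda>z. z powi (-1) * s z) h" if "h \<in> L2T" for h
  proof (rule l2_inner_cong_AE)
    show "AE z in circle_measure. s' z * cnj (h z) = z powi - 1 * s z * cnj (h z)"
      using AE_circle_cmod
      by eventually_elim (use cnj_powi_unit[of _ 1] in \<open>simp add: s_def s'_def J_def\<close>)
  qed (use that[THEN L2T_measurable] in measurable)
  \<comment> \<open>\<open>\<Gamma> (z g)\<close> has the coefficients of \<open>\<Gamma> g\<close> shifted by one, as \<open>J\<close> turns \<open>z\<close> into \<open>z\<^sup>-\<^sup>1\<close>\<close>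
  have coeff_F: "fourier_coeff F n = fourier_coeff s n" "fourier_coeff F' n = fourier_coeff s (n + 1)"
    if "n \<ge> 0" for n
    using l2_inner_hankel[OF g H2_powi[OF that]] l2_inner_hankel[OF g' H2_powi[OF that]]
      s's[OF L2T_powi[of n]] fourier_coeff_powi_mult[OF L(1), of "-1" n]
    by (simp_all add: F_def F'_def s_def s'_def fourier_coeff_def)
  have c: "c = fourier_coeff s 0" by (simp add: c_def s_def fourier_coeff_def l2_inner_def)
  have coeff_D: "fourier_coeff D n = fourier_coeff F n - fourier_coeff F' (n - 1) - (if n = 0 then c else 0)" for n
    unfolding D_def using L fourier_coeff_powi_mult[OF L(4), of 1 n]
    by (simp add: fourier_coeff_diff fourier_coeff_const)
  \<comment> \<open>the subtracted constant takes care of the index \<open>0\<close>, which the shift does not reach\<close>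
  have D0: "fourier_coeff D n = 0" for n
    using F coeff_F[of n] coeff_F(2)[of "n - 1"] unfolding coeff_D c
    by (cases "n = 0"; cases "n > 0") (auto simp: H2_def)
  have DH: "D \<in> H2" and DH': "(\<lambda>z. z powi (-1) * D z) \<in> H2"
    using DL D0 L2T_powi_mult[OF DL, of "-1"] fourier_coeff_powi_mult[OF DL, of "-1"]
    by (simp_all add: H2_def)
  have "l2_inner F D = l2_inner s D"
    unfolding F_def s_def by (rule l2_inner_hankel[OF g DH])
  moreover have "l2_inner (\<lambda>z. z powi 1 * F' z) D = l2_inner s D"
  proof -
    have "l2_inner (\<lambda>z. z powi 1 * F' z) D = l2_inner F' (\<lambda>z. z powi (-1) * D z)"
      by (rule l2_inner_powi_mult[OF L(4) DL])
    also have "\<dots> = l2_inner s' (\<lambda>z. z powi (-1) * D z)"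
      unfolding F'_def s'_def by (rule l2_inner_hankel[OF g' DH'])
    also have "\<dots> = l2_inner (\<lambda>z. z powi (-1) * s z) (\<lambda>z. z powi (-1) * D z)"
      by (rule s's[OF H2_L2T[OF DH']])
    also have "\<dots> = l2_inner s (\<lambda>z. z powi (- (-1)) * (z powi (-1) * D z))"
      by (rule l2_inner_powi_mult[OF L(1) H2_L2T[OF DH']])
    also have "\<dots> = l2_inner s D"
    proof (rule l2_inner_cong_AE)
      show "AE z in circle_measure. s z * cnj (z powi (- (-1)) * (z powi (-1) * D z)) = s z * cnj (D z)"
        using AE_circle_cmod
      proof eventually_elim
        case (elim z)
        hence "z \<noteq> 0" by auto
        thus ?case by (simp add: power_int_minus)
      qed
    qed (use DL[THEN L2T_measurable] in measurable)
    finally show ?thesis .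
  qed
  moreover have "l2_inner (\<lambda>z. c) D = 0"
    using D0[of 0] l2_inner_commute[of "\<lambda>_. 1" D] l2_inner_scale_left[of c "\<lambda>_. 1" D]
    by (simp add: fourier_coeff_def)
  moreover have "l2_inner D D = l2_inner F D - l2_inner (\<lambda>z. z powi 1 * F' z) D - l2_inner (\<lambda>z. c) D"
    using l2_inner_diff_left[OF L(6) L2T_const DL, of c] l2_inner_diff_left[OF L(3,5) DL]
    by (simp add: D_def)
  ultimately have "l2_inner D D = 0" by simp
  hence "l2_norm D = 0" by (simp add: l2_inner_self)
  from l2_norm_eq_0_imp_AE[OF DL this] show ?thesis
    by eventually_elim (simp add: D_def F_def F'_def c_def algebra_simps)
qed

lemma H2_in_Lat: "H2 \<in> Lat (hankel hilbert_symbol)"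
  by (auto simp: Lat_def closed_subspace_H2_def hankel_H2 H2_add H2_scale)

section \<open>Boundary values of bounded analytic functions\<close>

definition taylor_coeff :: "(complex \<Rightarrow> complex) \<Rightarrow> nat \<Rightarrow> complex" where
  "taylor_coeff u n = (deriv ^^ n) u 0 / fact n"

text \<open>
  A sequence increasing to \<open>1\<close>. Working along a sequence makes limits of measurable functions
  measurable and gives access to dominated convergence.
\<close>

definition radius :: "nat \<Rightarrow> real" where
  "radius n = 1 - 1 / real (Suc n)"

lemma radius_bounds: "0 \<le> radius n" "radius n < 1"
  by (auto simp: radius_def)

lemma radius_tendsto: "radius \<longlonglongrightarrow> 1"
proof -
  have "(\<lambda>n. 1 / real (Suc n)) \<longlonglongrightarrow> 0"
    using LIMSEQ_inverse_real_of_nat by (simp add: inverse_eq_divide)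
  from tendsto_diff[OF tendsto_const[of 1] this]
  show ?thesis by (simp add: radius_def[abs_def])
qed

lemma radius_at_left: "filterlim radius (at_left 1) sequentially"
  by (intro tendsto_imp_filterlim_at_left radius_tendsto always_eventually allI radius_bounds)

text \<open>
  On the closed disc this is \<open>u(r\<^sub>n z)\<close>. The power series makes it Borel measurable on the whole plane,
  whereas \<open>u\<close> itself is arbitrary outside the disc.
\<close>

definition dilate :: "(complex \<Rightarrow> complex) \<Rightarrow> nat \<Rightarrow> complex \<Rightarrow> complex" where
  "dilate u n z = (\<Sum>m. taylor_coeff u m * (of_real (radius n) * z) ^ m)"

lemma cmod_radius_mult:
  assumes "cmod z \<le> 1"
  shows "cmod (of_real (radius n) * z) < 1"
proof -
  have "radius n * cmod z \<le> radius n * 1"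
    by (intro mult_left_mono assms radius_bounds)
  thus ?thesis using radius_bounds[of n] by (simp add: norm_mult)
qed

lemma taylor_sums:
  assumes "u \<in> Hinf" "cmod w < 1"
  shows "(\<lambda>m. taylor_coeff u m * w ^ m) sums u w"
  using holomorphic_power_series[of u 0 1 w] assms by (simp add: Hinf_def taylor_coeff_def)

text \<open>
  The series converges at a point between \<open>r\<close> and \<open>1\<close>.
\<close>

lemma taylor_summable_norm:
  assumes "u \<in> Hinf" "0 \<le> r" "r < 1"
  shows "summable (\<lambda>m. cmod (taylor_coeff u m) * r ^ m)"
proof -
  define s where "s = (r + 1) / 2"
  have s: "0 \<le> r" "r < s" "s < 1" using assms by (auto simp: s_def)
  have "summable (\<lambda>m. taylor_coeff u m * (of_real s) ^ m)"
    using taylor_sums[OF assms(1), of "of_real s"] s by (auto simp: sums_iff)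
  from powser_insidea[OF this, of "of_real r"] s
  show ?thesis by (simp add: norm_mult norm_power)
qed

lemma dilate_eq:
  assumes "u \<in> Hinf" "cmod z \<le> 1"
  shows "dilate u n z = u (of_real (radius n) * z)"
  unfolding dilate_def
  using taylor_sums[OF assms(1) cmod_radius_mult[OF assms(2)]] by (simp add: sums_iff)

lemma dilate_measurable [measurable]: "dilate u n \<in> borel_measurable borel"
  unfolding dilate_def[abs_def] by measurable

lemma Hinf_bound:
  assumes "u \<in> Hinf"
  obtains B where "B \<ge> 0" "\<And>z. cmod z < 1 \<Longrightarrow> cmod (u z) \<le> B"
proof -
  from assms obtain B where B: "\<forall>z\<in>ball 0 1. cmod (u z) \<le> B"
    by (auto simp: Hinf_def bounded_iff)
  have "0 \<le> cmod (u 0)" by simp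
  also have "\<dots> \<le> B" using B by simp
  finally have "0 \<le> B" .
  with that[of B] B show ?thesis by simp
qed

text \<open>
  For \<open>r < 1\<close> the Taylor series of \<open>u(r p(x))\<close> converges uniformly in \<open>x\<close> and may be integrated term by
  term; as \<open>r\<close> tends to \<open>1\<close>, dominated convergence applies because \<open>u\<close> is bounded. Hence the integral
  against the boundary values \<open>g\<close> depends only on the Taylor coefficients of \<open>u\<close> and on the moments
  \<open>\<integral> w p\<^sup>m\<close>. Two pairs of measure and weight with the same moments thus give the same integral, which
  is how an integral over the circle is turned into one over \<open>[0, 1)\<close>.
\<close>

lemma abel_moments:
  assumes "finite_measure M" and u: "u \<in> Hinf"
    and [measurable]: "w \<in> borel_measurable M" "p \<in> borel_measurable M" "g \<in> borel_measurable M"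
    and w: "\<And>x. x \<in> space M \<Longrightarrow> cmod (w x) \<le> C"
    and p: "AE x in M. cmod (p x) \<le> 1"
    and g: "AE x in M. (\<lambda>n. dilate u n (p x)) \<longlonglongrightarrow> g x"
  shows "(\<lambda>n. \<Sum>m. taylor_coeff u m * of_real (radius n) ^ m * (\<integral>x. w x * p x ^ m \<partial>M))
           \<longlonglongrightarrow> (\<integral>x. w x * g x \<partial>M)"
proof -
  interpret finite_measure M by fact
  obtain B where B: "B \<ge> 0" "\<And>z. cmod z < 1 \<Longrightarrow> cmod (u z) \<le> B" using Hinf_bound[OF u] by blast
  define C' where "C' = max C 0"
  have C': "C' \<ge> 0" "\<And>x. x \<in> space M \<Longrightarrow> cmod (w x) \<le> C'"
    using w by (auto simp: C'_def intro: order_trans[OF _ max.cobounded1])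
  have "(\<Sum>m. taylor_coeff u m * of_real (radius n) ^ m * (\<integral>x. w x * p x ^ m \<partial>M))
          = (\<integral>x. w x * dilate u n (p x) \<partial>M)" for n
  proof -
    define f where "f = (\<lambda>m x. taylor_coeff u m * of_real (radius n) ^ m * (w x * p x ^ m))"
    define K where "K = (\<lambda>m. cmod (taylor_coeff u m) * radius n ^ m * C')"
    have sK: "summable K"
      unfolding K_def by (intro summable_mult2 taylor_summable_norm u radius_bounds)
    have bd: "AE x in M. \<forall>m. cmod (f m x) \<le> K m"
      using p AE_space
    proof eventually_elim
      case (elim x)
      have "cmod (w x * p x ^ m) \<le> C' * 1" for m
        unfolding norm_mult norm_power
        using elim C' by (intro mult_mono power_le_one) auto
      thus ?case
        using radius_bounds[of n] unfolding f_def K_def norm_mult norm_power norm_of_real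
        by (auto simp: mult.assoc norm_mult norm_power intro!: mult_left_mono)
    qed
    have [measurable]: "f m \<in> borel_measurable M" for m unfolding f_def by measurable
    have int: "integrable M (f m)" for m
      by (rule integrable_const_bound[where B = "K m"]) (use bd in auto)
    have s1: "AE x in M. summable (\<lambda>m. norm (f m x))"
      using bd by eventually_elim (rule summable_comparison_test'[OF sK], simp)
    have s2: "summable (\<lambda>m. \<integral>x. norm (f m x) \<partial>M)"
    proof (rule summable_comparison_test'[where N = 0])
      show "summable (\<lambda>m. K m * measure M (space M))" by (rule summable_mult2[OF sK])
      fix m
      have "(\<integral>x. norm (f m x) \<partial>M) \<le> (\<integral>x. K m \<partial>M)"
        by (rule integral_mono_AE) (use bd int in auto)
      thus "norm (\<integral>x. norm (f m x) \<partial>M) \<le> K m * measure M (space M)"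
        by (simp add: mult.commute)
    qed
    have "(\<Sum>m. \<integral>x. f m x \<partial>M) = (\<integral>x. (\<Sum>m. f m x) \<partial>M)"
      using integral_suminf[OF int s1 s2] by simp
    also have "\<dots> = (\<integral>x. w x * dilate u n (p x) \<partial>M)"
    proof (rule integral_cong_AE)
      show "AE x in M. (\<Sum>m. f m x) = w x * dilate u n (p x)"
        using p
      proof eventually_elim
        case (elim x)
        hence "summable (\<lambda>m. taylor_coeff u m * (of_real (radius n) * p x) ^ m)"
          using taylor_sums[OF u cmod_radius_mult] by (simp add: sums_iff)
        from suminf_mult[OF this, of "w x"] show ?case
          by (simp add: f_def dilate_def power_mult_distrib mult_ac)
      qed
    qed measurable
    finally show ?thesis by (simp add: f_def)
  qed
  moreover have "(\<lambda>n. \<integral>x. w x * dilate u n (p x) \<partial>M) \<longlonglongrightarrow> (\<integral>x. w x * g x \<partial>M)"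
  proof (rule integral_dominated_convergence[where w = "\<lambda>_. C' * B"])
    show "AE x in M. (\<lambda>n. w x * dilate u n (p x)) \<longlonglongrightarrow> w x * g x"
      using g by eventually_elim (intro tendsto_intros)
    show "AE x in M. norm (w x * dilate u n (p x)) \<le> C' * B" for n
      using p AE_space
    proof eventually_elim
      case (elim x)
      thus ?case
        unfolding norm_mult dilate_eq[OF u elim(1)]
        by (intro mult_mono B C' cmod_radius_mult) auto
    qed
  qed auto
  ultimately show ?thesis by simp
qed

text \<open>
  A Borel version of the radial limit of an inner function.
\<close>

definition boundary :: "(complex \<Rightarrow> complex) \<Rightarrow> complex \<Rightarrow> complex" where
  "boundary u z = lim (\<lambda>n. dilate u n z)"

lemma boundary_measurable [measurable]: "boundary u \<in> borel_measurable borel"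
  unfolding boundary_def[abs_def] by measurable

lemma inner_boundary:
  assumes "inner_function u"
  shows "AE z in circle_measure. (\<lambda>n. dilate u n z) \<longlonglongrightarrow> boundary u z \<and>
           radial_limit u z = boundary u z \<and> cmod (boundary u z) = 1"
proof -
  have u: "u \<in> Hinf" and ae: "AE z in circle_measure.
      \<exists>l. ((\<lambda>r. u (complex_of_real r * z)) \<longlongrightarrow> l) (at_left 1) \<and> cmod l = 1"
    using assms by (auto simp: inner_function_def)
  from ae AE_circle_cmod show ?thesis
  proof eventually_elim
    case (elim z)
    then obtain l where l: "((\<lambda>r. u (complex_of_real r * z)) \<longlongrightarrow> l) (at_left 1)" "cmod l = 1" by blast
    have "(\<lambda>n. dilate u n z) \<longlonglongrightarrow> l"
      using filterlim_compose[OF l(1) radius_at_left] elim by (simp add: dilate_eq[OF u])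
    moreover from this have "boundary u z = l" unfolding boundary_def by (rule limI)
    moreover have "radial_limit u z = l" unfolding radial_limit_def by (rule tendsto_Lim[OF _ l(1)]) simp
    ultimately show ?case using l by simp
  qed
qed

lemma boundary_L2T:
  assumes "inner_function u"
  shows "boundary u \<in> L2T"
  by (rule L2T_bounded[where B = 1]) (use inner_boundary[OF assms] in auto)

text \<open>
  The moments of the weight \<open>z\<^sup>-\<^sup>k\<close> on the circle single out the index \<open>k\<close>.
\<close>

lemma fourier_coeff_boundary:
  assumes "inner_function u"
  shows "fourier_coeff (boundary u) (int k) = taylor_coeff u k"
proof -
  have u: "u \<in> Hinf" using assms by (simp add: inner_function_def)
  \<comment> \<open>cut off so that the weight is bounded on the whole plane\<close>
  define w where "w = (\<lambda>z. if cmod z = 1 then z powi (- int k) else 0)"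
  have [measurable]: "w \<in> borel_measurable borel" unfolding w_def by measurable
  have "(\<lambda>n. \<Sum>m. taylor_coeff u m * of_real (radius n) ^ m * (\<integral>z. w z * z ^ m \<partial>circle_measure))
          \<longlonglongrightarrow> (\<integral>z. w z * boundary u z \<partial>circle_measure)"
  proof (rule abel_moments[OF _ u, where C = 1])
    show "finite_measure circle_measure" by (rule circle.finite_measure_axioms)
    show "AE z in circle_measure. cmod z \<le> 1" using AE_circle_cmod by eventually_elim simp
    show "AE z in circle_measure. (\<lambda>n. dilate u n z) \<longlonglongrightarrow> boundary u z"
      using inner_boundary[OF assms] by eventually_elim simp
  qed (auto simp: w_def norm_power_int)
  moreover have "(\<integral>z. w z * z ^ m \<partial>circle_measure) = (if m = k then 1 else 0)" for m
  proof -
    have "(\<integral>z. w z * z ^ m \<partial>circle_measure) = (\<integral>z. z powi (int m - int k) \<partial>circle_measure)"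
    proof (rule integral_cong_AE)
      show "AE z in circle_measure. w z * z ^ m = z powi (int m - int k)"
        using AE_circle_cmod
      proof eventually_elim
        case (elim z)
        hence "z \<noteq> 0" by auto
        thus ?case using elim by (simp add: w_def power_int_diff power_int_minus field_simps)
      qed
    qed measurable
    thus ?thesis by (simp add: integral_powi_circle)
  qed
  moreover have "(\<Sum>m. taylor_coeff u m * of_real (radius n) ^ m * (if m = k then 1 else 0))
      = taylor_coeff u k * of_real (radius n) ^ k" for n
    using sums_unique[OF sums_single[of k "\<lambda>m. taylor_coeff u m * of_real (radius n) ^ m"]]
    by (simp add: if_distrib cong: if_cong)
  moreover have "(\<lambda>n. taylor_coeff u k * of_real (radius n) ^ k) \<longlonglongrightarrow> taylor_coeff u k * of_real 1 ^ k"
    by (intro tendsto_intros radius_tendsto)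
  ultimately have "(\<integral>z. w z * boundary u z \<partial>circle_measure) = taylor_coeff u k"
    using LIMSEQ_unique by fastforce
  moreover have "(\<integral>z. w z * boundary u z \<partial>circle_measure) = fourier_coeff (boundary u) (int k)"
    unfolding fourier_coeff_def l2_inner_def
  proof (rule integral_cong_AE)
    show "AE z in circle_measure. w z * boundary u z = boundary u z * cnj (z powi int k)"
      using AE_circle_cmod by eventually_elim (use cnj_powi_unit[of _ "int k"] in \<open>simp add: w_def\<close>)
  qed measurable
  ultimately show ?thesis by simp
qed

section \<open>Moments on the unit interval\<close>

text \<open>
  The endpoint \<open>1\<close> is left out because \<open>u\<close> need not be regular there.
\<close>

abbreviation unit_interval :: "real measure" where
  "unit_interval \<equiv> restrict_space lborel {0..<1}"

lemma finite_measure_unit_interval: "finite_measure unit_interval"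
  by (rule finite_measureI) (simp add: emeasure_restrict_space space_restrict_space)

lemma unit_interval_moment:
  "(\<integral>x. complex_of_real x ^ n \<partial>unit_interval) = 1 / of_nat (Suc n)"
proof -
  have "(\<integral>x. x ^ n \<partial>unit_interval) = (\<integral>x. indicator {0..<1} x *\<^sub>R x ^ n \<partial>lborel)"
    by (rule integral_restrict_space) simp
  also have "\<dots> = (\<integral>x. x ^ n * indicator {0..1} x \<partial>lborel)"
  proof (rule integral_cong_AE)
    show "AE x in lborel. indicator {0..<1} x *\<^sub>R x ^ n = x ^ n * indicator {0..1::real} x"
      using AE_lborel_singleton[of 1] by eventually_elim (auto simp: indicator_def)
  qed measurable
  also have "\<dots> = 1 / real (Suc n)" by (subst integral_power) auto
  finally have "complex_of_real (\<integral>x. x ^ n \<partial>unit_interval) = 1 / of_nat (Suc n)"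
    by simp
  thus ?thesis by (simp flip: integral_complex_of_real)
qed

lemma Hinf_measurable_unit_interval:
  assumes "u \<in> Hinf"
  shows "(\<lambda>x. u (complex_of_real x)) \<in> borel_measurable unit_interval"
proof -
  have "continuous_on (ball 0 1) u"
    using assms by (auto simp: Hinf_def intro: holomorphic_on_imp_continuous_on)
  hence "continuous_on {0..<1} (\<lambda>x::real. u (complex_of_real x))"
    by (rule continuous_on_compose2) (auto intro!: continuous_intros)
  from borel_measurable_continuous_on_restrict[OF this] show ?thesis
    by (simp add: measurable_def space_restrict_space sets_restrict_space)
qed

text \<open>
  The left-hand side is \<open>\<langle>\<Gamma> (z\<^sup>k u), 1\<rangle>\<close>. The weight \<open>\<psi>(z\<^sup>*) z\<^sup>k\<close> on the circle, with \<open>z\<^sup>*\<close> the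
  conjugate of \<open>z\<close>, and the weight \<open>x\<^sup>k\<close> on \<open>[0, 1)\<close> have the same moments \<open>1 / (m + k + 1)\<close>.
\<close>

lemma hilbert_symbol_boundary_moment:
  assumes "inner_function u"
  shows "(\<integral>z. hilbert_symbol z * cnj z ^ k * boundary u (cnj z) \<partial>circle_measure) =
         (\<integral>x. complex_of_real x ^ k * u (complex_of_real x) \<partial>unit_interval)"
proof -
  note [measurable] = hilbert_symbol_measurable
  have u: "u \<in> Hinf" using assms by (simp add: inner_function_def)
  \<comment> \<open>cut off so that the weight is bounded on the whole plane\<close>
  define w where "w = (\<lambda>z. if cmod z = 1 then hilbert_symbol (cnj z) * z ^ k else 0)"
  have [measurable]: "w \<in> borel_measurable borel" unfolding w_def by measurable
  have w_AE: "AE z in circle_measure. w z = hilbert_symbol (cnj z) * z ^ k"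
    using AE_circle_cmod by eventually_elim (simp add: w_def)
  have lim1: "(\<lambda>n. \<Sum>m. taylor_coeff u m * of_real (radius n) ^ m * (\<integral>z. w z * z ^ m \<partial>circle_measure))
          \<longlonglongrightarrow> (\<integral>z. w z * boundary u z \<partial>circle_measure)"
  proof (rule abel_moments[OF _ u, where C = pi])
    show "finite_measure circle_measure" by (rule circle.finite_measure_axioms)
    show "AE z in circle_measure. cmod z \<le> 1" using AE_circle_cmod by eventually_elim simp
    show "AE z in circle_measure. (\<lambda>n. dilate u n z) \<longlonglongrightarrow> boundary u z"
      using inner_boundary[OF assms] by eventually_elim simp
  qed (auto simp: w_def norm_mult norm_power hilbert_symbol_bounded)
  have lim2: "(\<lambda>n. \<Sum>m. taylor_coeff u m * of_real (radius n) ^ m *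
                 (\<integral>x. complex_of_real x ^ k * complex_of_real x ^ m \<partial>unit_interval))
          \<longlonglongrightarrow> (\<integral>x. complex_of_real x ^ k * u (complex_of_real x) \<partial>unit_interval)"
  proof (rule abel_moments[OF finite_measure_unit_interval u, where C = 1])
    show "AE x in unit_interval. (\<lambda>n. dilate u n (complex_of_real x)) \<longlonglongrightarrow> u (complex_of_real x)"
    proof (rule AE_I2)
      fix x assume "x \<in> space unit_interval"
      hence x: "0 \<le> x" "x < 1" by (auto simp: space_restrict_space)
      have "isCont u (complex_of_real x)"
        using u x holomorphic_on_imp_continuous_on[of u "ball 0 1"]
        by (auto simp: Hinf_def continuous_on_eq_continuous_at)
      moreover have "(\<lambda>n. complex_of_real (radius n) * complex_of_real x) \<longlonglongrightarrow> complex_of_real 1 * complex_of_real x"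
        by (intro tendsto_intros radius_tendsto)
      ultimately have "(\<lambda>n. u (complex_of_real (radius n) * complex_of_real x)) \<longlonglongrightarrow> u (complex_of_real x)"
        using isCont_tendsto_compose by fastforce
      thus "(\<lambda>n. dilate u n (complex_of_real x)) \<longlonglongrightarrow> u (complex_of_real x)"
        using x by (simp add: dilate_eq[OF u])
    qed
  qed (auto simp: space_restrict_space norm_power power_le_one Hinf_measurable_unit_interval[OF u] intro!: AE_I2 measurable_restrict_space1)
  have "(\<integral>z. w z * z ^ m \<partial>circle_measure) = (\<integral>x. complex_of_real x ^ k * complex_of_real x ^ m \<partial>unit_interval)" for m
  proof -
    have "(\<integral>z. w z * z ^ m \<partial>circle_measure) = (\<integral>z. hilbert_symbol (cnj z) * cnj (cnj z) ^ (m + k) \<partial>circle_measure)"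
      by (rule integral_cong_AE) (use w_AE in \<open>auto simp: power_add\<close>)
    also have "\<dots> = (\<integral>z. hilbert_symbol z * cnj z ^ (m + k) \<partial>circle_measure)"
      by (rule circle_integral_cnj) measurable
    also have "\<dots> = 1 / of_nat (Suc (m + k))"
      using fourier_coeff_hilbert_symbol[of "m + k" 0] by (simp add: fourier_coeff_def l2_inner_def J_def)
    also have "\<dots> = (\<integral>x. complex_of_real x ^ k * complex_of_real x ^ m \<partial>unit_interval)"
      by (simp only: unit_interval_moment[symmetric] power_add mult.commute)
    finally show ?thesis .
  qed
  with lim1 lim2 have "(\<integral>z. w z * boundary u z \<partial>circle_measure) =
      (\<integral>x. complex_of_real x ^ k * u (complex_of_real x) \<partial>unit_interval)"
    using LIMSEQ_unique by simp
  moreover have "(\<integral>z. hilbert_symbol z * cnj z ^ k * boundary u (cnj z) \<partial>circle_measure) =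
      (\<integral>z. hilbert_symbol (cnj z) * cnj (cnj z) ^ k * boundary u (cnj (cnj z)) \<partial>circle_measure)"
    by (rule circle_integral_cnj[symmetric]) measurable
  moreover have "\<dots> = (\<integral>z. w z * boundary u z \<partial>circle_measure)"
    by (rule integral_cong_AE) (use w_AE in auto)
  ultimately show ?thesis by simp
qed

text \<open>
  By Weierstrass approximation \<open>v\<close> is orthogonal to itself.
\<close>

lemma continuous_zero_moments:
  fixes v :: "real \<Rightarrow> real"
  assumes v: "continuous_on {0..1} v"
    and mom: "\<And>k. integral {0..1} (\<lambda>x. x ^ k * v x) = 0"
    and x: "x \<in> {0..1}"
  shows "v x = 0"
proof -
  define K where "K = integral {0..1} (\<lambda>x. \<bar>v x\<bar>)"
  have int: "h integrable_on {0..1}" if "continuous_on {0..1} h" for h :: "real \<Rightarrow> real"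
    by (rule integrable_continuous_real[OF that])
  have K: "K \<ge> 0" unfolding K_def by (rule integral_nonneg) (auto intro!: int continuous_intros v)
  have le: "integral {0..1} (\<lambda>x. v x * v x) \<le> e * K" if e: "e > 0" for e
  proof -
    obtain q where q: "real_polynomial_function q" "\<And>x. x \<in> {0..1} \<Longrightarrow> \<bar>v x - q x\<bar> < e"
      using Stone_Weierstrass_real_polynomial_function[OF compact_Icc v e] by blast
    then obtain a n where an: "q = (\<lambda>x. \<Sum>i\<le>n. a i * x ^ i)"
      by (auto simp: real_polynomial_function_iff_sum)
    have cq: "continuous_on {0..1} q" unfolding an by (intro continuous_intros)
    have "integral {0..1} (\<lambda>x. q x * v x) = integral {0..1} (\<lambda>x. \<Sum>i\<le>n. a i * (x ^ i * v x))"
      by (simp add: an sum_distrib_right mult.assoc)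
    also have "\<dots> = (\<Sum>i\<le>n. integral {0..1} (\<lambda>x. a i * (x ^ i * v x)))"
      by (rule integral_sum) (auto intro!: int continuous_intros v)
    also have "\<dots> = 0" by (simp add: mom)
    finally have "integral {0..1} (\<lambda>x. v x * v x) = integral {0..1} (\<lambda>x. v x * v x) - integral {0..1} (\<lambda>x. q x * v x)"
      by simp
    also have "\<dots> = integral {0..1} (\<lambda>x. v x * v x - q x * v x)"
      by (rule integral_diff[symmetric]) (auto intro!: int continuous_intros v cq)
    also have "\<dots> \<le> integral {0..1} (\<lambda>x. e * \<bar>v x\<bar>)"
    proof (rule integral_le)
      fix x :: real assume x: "x \<in> {0..1}"
      have "v x * v x - q x * v x \<le> \<bar>v x - q x\<bar> * \<bar>v x\<bar>"
        by (metis abs_ge_self abs_mult left_diff_distrib)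
      also have "\<dots> \<le> e * \<bar>v x\<bar>" using q(2)[OF x] by (intro mult_right_mono) auto
      finally show "v x * v x - q x * v x \<le> e * \<bar>v x\<bar>" .
    qed (auto intro!: int continuous_intros v cq)
    also have "\<dots> = e * K" by (simp add: K_def)
    finally show ?thesis .
  qed
  have "integral {0..1} (\<lambda>x. v x * v x) \<le> 0"
  proof (rule field_le_epsilon)
    fix e :: real assume "e > 0"
    hence "integral {0..1} (\<lambda>x. v x * v x) \<le> e / (K + 1) * K"
      using K by (intro le) simp
    also have "\<dots> \<le> e" using K \<open>e > 0\<close> by (simp add: field_simps)
    finally show "integral {0..1} (\<lambda>x. v x * v x) \<le> 0 + e" by simp
  qed
  moreover have "integral {0..1} (\<lambda>x. v x * v x) \<ge> 0"
    by (rule integral_nonneg) (auto intro!: int continuous_intros v)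
  ultimately have "((\<lambda>x. v x * v x) has_integral 0) (cbox 0 1)"
    using integrable_integral[OF int[OF continuous_on_mult[OF v v]]] by (simp add: cbox_interval)
  from has_integral_0_cbox_imp_0[OF _ _ this, of x] x continuous_on_mult[OF v v]
  have "v x * v x = 0" by (auto simp: cbox_interval box_real)
  thus ?thesis by simp
qed

text \<open>
  To obtain a function that is continuous on all of \<open>[0, 1]\<close>, \<open>u\<close> is multiplied by \<open>1 - x\<close>; the moments
  of the product are differences of consecutive moments of \<open>u\<close>.
\<close>

lemma Hinf_zero_moments:
  assumes u: "u \<in> Hinf"
    and mom: "\<And>k. (\<integral>x. complex_of_real x ^ k * u (complex_of_real x) \<partial>unit_interval) = 0"
    and w: "w \<in> ball 0 1"
  shows "u w = 0"
proof -
  interpret I: finite_measure unit_interval by (rule finite_measure_unit_interval)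
  obtain B where B: "B \<ge> 0" "\<And>z. cmod z < 1 \<Longrightarrow> cmod (u z) \<le> B" using Hinf_bound[OF u] by blast
  \<comment> \<open>\<open>V\<close> tends to \<open>0\<close> at \<open>1\<close> because \<open>u\<close> is bounded\<close>
  define V where "V = (\<lambda>x::real. if x = 1 then 0 else complex_of_real (1 - x) * u (complex_of_real x))"
  have cV: "continuous_on {0..1} V"
    unfolding continuous_on_eq_continuous_within
  proof
    fix x :: real assume x: "x \<in> {0..1}"
    show "continuous (at x within {0..1}) V"
    proof (cases "x = 1")
      case True
      have "(V \<longlongrightarrow> 0) (at 1 within {0..1})"
      proof (rule tendsto_0_le[where K = B])
        show "((\<lambda>x::real. 1 - x) \<longlongrightarrow> 0) (at 1 within {0..1})"
          by (rule tendsto_eq_intros refl)+ simp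
        show "\<forall>\<^sub>F x in at 1 within {0..1}. norm (V x) \<le> norm (1 - x) * B"
          unfolding eventually_at_filter
        proof (intro always_eventually allI impI)
          fix y :: real assume y: "y \<noteq> 1" "y \<in> {0..1}"
          hence "cmod (u (complex_of_real y)) \<le> B" by (intro B) auto
          thus "norm (V y) \<le> norm (1 - y) * B"
            using y unfolding V_def by (auto simp: norm_mult simp flip: of_real_diff intro!: mult_left_mono)
        qed
      qed
      thus ?thesis using True by (simp add: continuous_within V_def)
    next
      case False
      hence x1: "0 \<le> x" "x < 1" using x by auto
      have "isCont u (complex_of_real x)"
        using u x1 holomorphic_on_imp_continuous_on[of u "ball 0 1"]
        by (auto simp: Hinf_def continuous_on_eq_continuous_at)
      hence "isCont (\<lambda>x. complex_of_real (1 - x) * u (complex_of_real x)) x"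
        by (intro continuous_intros isCont_o2[of x complex_of_real u]) auto
      moreover have "\<forall>\<^sub>F y in nhds x. V y = complex_of_real (1 - y) * u (complex_of_real y)"
        using t1_space_nhds[OF False] by eventually_elim (simp add: V_def)
      ultimately have "isCont V x" by (simp only: isCont_cong)
      thus ?thesis by (rule continuous_at_imp_continuous_at_within)
    qed
  qed
  have momV: "integral {0..1} (\<lambda>x. x ^ k *\<^sub>R V x) = 0" for k
  proof -
    define h where "h = (\<lambda>k x. complex_of_real x ^ k * u (complex_of_real x))"
    have int: "integrable unit_interval (h k)" for k
    proof (rule I.integrable_const_bound)
      show "AE x in unit_interval. norm (h k x) \<le> 1 * B"
      proof (rule AE_I2)
        fix x assume "x \<in> space unit_interval"
        hence x: "0 \<le> x" "x < 1" by (auto simp: space_restrict_space)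
        show "norm (h k x) \<le> 1 * B"
          unfolding h_def norm_mult using x B by (intro mult_mono) (auto simp: norm_power power_le_one)
      qed
      have "complex_of_real \<in> borel_measurable unit_interval"
        by (rule measurable_restrict_space1) simp
      thus "h k \<in> borel_measurable unit_interval"
        unfolding h_def
        by (intro borel_measurable_times borel_measurable_power Hinf_measurable_unit_interval[OF u])
    qed
    have "set_integrable lborel {0..1} (\<lambda>x. x ^ k *\<^sub>R V x)"
      unfolding set_integrable_def by (intro borel_integrable_compact continuous_intros cV) auto
    hence "integral {0..1} (\<lambda>x. x ^ k *\<^sub>R V x) = (\<integral>x. indicator {0..1} x *\<^sub>R (x ^ k *\<^sub>R V x) \<partial>lborel)"
      using set_borel_integral_eq_integral(2) by (metis set_lebesgue_integral_def)
    also have "\<dots> = (\<integral>x. indicator {0..<1} x *\<^sub>R (h k x - h (Suc k) x) \<partial>lborel)"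
      by (intro Bochner_Integration.integral_cong refl)
         (auto simp: indicator_def V_def h_def scaleR_conv_of_real algebra_simps)
    also have "\<dots> = (\<integral>x. h k x - h (Suc k) x \<partial>unit_interval)"
      by (rule integral_restrict_space[symmetric]) simp
    also have "\<dots> = (\<integral>x. h k x \<partial>unit_interval) - (\<integral>x. h (Suc k) x \<partial>unit_interval)"
      by (rule Bochner_Integration.integral_diff[OF int int])
    also have "\<dots> = 0" by (simp only: h_def mom diff_self)
    finally show ?thesis .
  qed
  have iV: "(\<lambda>x. x ^ k *\<^sub>R V x) integrable_on {0..1}" for k
    by (intro integrable_continuous_real continuous_intros cV)
  have V0: "V x = 0" if x: "x \<in> {0..1}" for x
  proof (rule complex_eqI)
    show "Re (V x) = Re 0"
      unfolding complex.sel zero_complex.sel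
    proof (rule continuous_zero_moments[OF _ _ x])
      show "continuous_on {0..1} (\<lambda>x. Re (V x))" by (intro continuous_intros cV)
      show "integral {0..1} (\<lambda>x. x ^ k * Re (V x)) = 0" for k
        using integral_linear[OF iV bounded_linear_Re, of k] by (simp add: o_def momV)
    qed
    show "Im (V x) = Im 0"
      unfolding complex.sel zero_complex.sel
    proof (rule continuous_zero_moments[OF _ _ x])
      show "continuous_on {0..1} (\<lambda>x. Im (V x))" by (intro continuous_intros cV)
      show "integral {0..1} (\<lambda>x. x ^ k * Im (V x)) = 0" for k
        using integral_linear[OF iV bounded_linear_Im, of k] by (simp add: o_def momV)
    qed
  qed
  have zero: "u (complex_of_real x) = 0" if "0 \<le> x" "x < 1" for x
    using V0[of x] that by (auto simp: V_def simp flip: of_real_diff)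
  show ?thesis
  proof (rule analytic_continuation[of u "ball 0 1" "complex_of_real ` {0..<1}" 0])
    show "u holomorphic_on ball 0 1" using u by (simp add: Hinf_def)
    show "0 islimpt complex_of_real ` {0..<1}"
      unfolding islimpt_approachable
    proof (intro allI impI)
      fix e :: real assume "e > 0"
      thus "\<exists>x'\<in>complex_of_real ` {0..<1}. x' \<noteq> 0 \<and> dist x' 0 < e"
        by (intro bexI[of _ "complex_of_real (min (1/2) (e/2))"] conjI imageI) (auto simp: min_def)
    qed
  qed (use w zero in auto)
qed

section \<open>Invariant subspaces generated by inner functions\<close>

lemma mult_H2_I:
  "g \<in> L2T \<Longrightarrow> f \<in> H2 \<Longrightarrow> AE z in circle_measure. g z = radial_limit u z * f z \<Longrightarrow> g \<in> mult_H2 u"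
  unfolding mult_H2_def by blast

lemma mult_H2_const:
  assumes c: "cmod c = 1" and u: "AE z in circle_measure. radial_limit u z = c"
  shows "mult_H2 u = H2"
proof (intro equalityI subsetI)
  fix g assume "g \<in> mult_H2 u"
  then obtain f where f: "g \<in> L2T" "f \<in> H2" "AE z in circle_measure. g z = radial_limit u z * f z"
    by (auto simp: mult_H2_def)
  have "AE z in circle_measure. g z = c * f z"
    using f(3) u by eventually_elim simp
  thus "g \<in> H2" by (rule H2_cong_AE[OF H2_scale[OF f(2)] f(1)])
next
  fix g assume g: "g \<in> H2"
  have "c \<noteq> 0" using c by auto
  show "g \<in> mult_H2 u"
  proof (rule mult_H2_I)
    show "AE z in circle_measure. g z = radial_limit u z * (inverse c * g z)"
      using u by eventually_elim (simp add: \<open>c \<noteq> 0\<close>)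
  qed (use g in \<open>auto intro: H2_L2T H2_scale\<close>)
qed

lemma inner_function_1: "inner_function (\<lambda>_. 1)"
  by (auto simp: inner_function_def Hinf_def bounded_iff intro!: exI[of _ 1] AE_I2)

lemma mult_H2_1: "mult_H2 (\<lambda>_. 1) = H2"
  by (rule mult_H2_const[where c = 1]) (auto simp: radial_limit_def intro!: AE_I2 tendsto_Lim)

text \<open>
  If \<open>1 = u h\<close> on the circle with \<open>h \<in> H\<^sup>2\<close>, then \<open>h\<close> is the conjugate of \<open>u\<close>, because \<open>|u| = 1\<close>. The
  vanishing negative Fourier coefficients of \<open>h\<close> are the conjugates of the Taylor coefficients of \<open>u\<close>
  of positive index, so \<open>u\<close> is constant.
\<close>

lemma one_in_mult_H2_imp:
  assumes u: "inner_function u" and one: "(\<lambda>_. 1) \<in> mult_H2 u"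
  shows "mult_H2 u = H2"
proof -
  note bd = inner_boundary[OF u]
  have uH: "u \<in> Hinf" using u by (simp add: inner_function_def)
  obtain h where h: "h \<in> H2" "AE z in circle_measure. 1 = radial_limit u z * h z"
    using one by (auto simp: mult_H2_def)
  note [measurable] = L2T_measurable[OF H2_L2T[OF h(1)]]
  have hU: "AE z in circle_measure. h z = cnj (boundary u z)"
    using h(2) bd
  proof eventually_elim
    case (elim z)
    hence "boundary u z * cnj (boundary u z) = 1" by (simp add: complex_norm_square[symmetric])
    thus ?case using elim by (metis inverse_unique)
  qed
  have tay: "taylor_coeff u m = 0" if m: "m > 0" for m
  proof -
    have "fourier_coeff h (- int m) = l2_inner (\<lambda>z. z powi int m) (boundary u)"
      unfolding fourier_coeff_def
    proof (rule l2_inner_cong_AE)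
      show "AE z in circle_measure. h z * cnj (z powi - int m) = z powi int m * cnj (boundary u z)"
        using hU AE_circle_cmod by eventually_elim (use cnj_powi_unit[of _ "- int m"] in \<open>simp\<close>)
    qed measurable
    also have "\<dots> = cnj (fourier_coeff (boundary u) (int m))"
      unfolding fourier_coeff_def by (rule l2_inner_commute)
    finally show ?thesis
      using h(1) m fourier_coeff_boundary[OF u, of m] by (simp add: H2_def)
  qed
  have u0: "u w = taylor_coeff u 0" if "cmod w < 1" for w
  proof -
    have "(\<lambda>m. taylor_coeff u m * w ^ m) = (\<lambda>m. if m = 0 then taylor_coeff u 0 else 0)"
      using tay by (auto simp: fun_eq_iff)
    with taylor_sums[OF uH that] sums_single[of 0 "\<lambda>_. taylor_coeff u 0"] show ?thesis
      by (metis (no_types, lifting) sums_unique2)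
  qed
  have rl: "AE z in circle_measure. radial_limit u z = taylor_coeff u 0"
    using bd AE_circle_cmod
  proof eventually_elim
    case (elim z)
    have "dilate u n z = taylor_coeff u 0" for n
      using elim by (simp add: dilate_eq[OF uH] u0 cmod_radius_mult)
    hence "boundary u z = taylor_coeff u 0" by (simp add: boundary_def)
    thus ?case using elim by simp
  qed
  have "AE z in circle_measure. cmod (taylor_coeff u 0) = 1"
    using rl bd by eventually_elim auto
  hence "cmod (taylor_coeff u 0) = 1" by (simp only: AE_circle_const)
  from mult_H2_const[OF this rl] show ?thesis .
qed

text \<open>
  It suffices to find \<open>1\<close> in the subspace. The constants supplied by \<open>hankel_shift\<close> belong to it, so the
  only obstacle is that they are all zero, in which case the moments of \<open>u\<close> on \<open>[0, 1)\<close> vanish.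
\<close>

lemma invariant_mult_H2:
  assumes u: "inner_function u" and inv: "mult_H2 u \<in> Lat (hankel hilbert_symbol)"
  shows "mult_H2 u = H2"
proof (rule one_in_mult_H2_imp[OF u])
  let ?M = "mult_H2 u" and ?H = "hankel hilbert_symbol"
  note bd = inner_boundary[OF u]
  have uH: "u \<in> Hinf" using u by (simp add: inner_function_def)
  have MH: "?M \<subseteq> H2" and add: "\<And>f g. f \<in> ?M \<Longrightarrow> g \<in> ?M \<Longrightarrow> (\<lambda>z. f z + g z) \<in> ?M"
    and scale: "\<And>c f. f \<in> ?M \<Longrightarrow> (\<lambda>z. c * f z) \<in> ?M" and HM: "\<And>f. f \<in> ?M \<Longrightarrow> ?H f \<in> ?M"
    using inv by (auto simp: Lat_def closed_subspace_H2_def)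
  have shift: "(\<lambda>z. z * g z) \<in> ?M" if "g \<in> ?M" for g
  proof -
    obtain f where f: "g \<in> L2T" "f \<in> H2" "AE z in circle_measure. g z = radial_limit u z * f z"
      using \<open>g \<in> ?M\<close> by (auto simp: mult_H2_def)
    show ?thesis
    proof (rule mult_H2_I)
      show "AE z in circle_measure. z * g z = radial_limit u z * (z * f z)"
        using f(3) by eventually_elim simp
      show "(\<lambda>z. z * f z) \<in> H2" using H2_powi_mult[OF f(2), of 1] by simp
      show "(\<lambda>z. z * g z) \<in> L2T" using L2T_powi_mult[OF f(1), of 1] by simp
    qed
  qed
  have powU: "(\<lambda>z. z ^ k * boundary u z) \<in> ?M" for k
  proof -
    show ?thesis
    proof (rule mult_H2_I)
      show "AE z in circle_measure. z ^ k * boundary u z = radial_limit u z * z powi int k"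
        using bd by eventually_elim simp
      show "(\<lambda>z. z ^ k * boundary u z) \<in> L2T"
        using L2T_powi_mult[OF boundary_L2T[OF u], of "int k"] by simp
    qed (use H2_powi[of "int k"] in simp)
  qed
  show "(\<lambda>_. 1) \<in> ?M"
  proof (cases "\<forall>g\<in>?M. (\<integral>z. hilbert_symbol z * J g z \<partial>circle_measure) = 0")
    case False
    then obtain g c where g: "g \<in> ?M" and c: "c = (\<integral>z. hilbert_symbol z * J g z \<partial>circle_measure)" "c \<noteq> 0"
      by blast
    have "(\<lambda>z. ?H g z + (-1) * (z * ?H (\<lambda>z. z * g z) z)) \<in> ?M"
      by (intro add scale shift HM g)
    hence "(\<lambda>z. inverse c * (?H g z + (-1) * (z * ?H (\<lambda>z. z * g z) z))) \<in> ?M"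
      by (rule scale)
    then obtain f where f: "f \<in> H2"
      "AE z in circle_measure. inverse c * (?H g z + (-1) * (z * ?H (\<lambda>z. z * g z) z)) = radial_limit u z * f z"
      by (auto simp: mult_H2_def)
    have "AE z in circle_measure. 1 = radial_limit u z * f z"
      using f(2) hankel_shift[OF subsetD[OF MH g]]
    proof eventually_elim
      case (elim z)
      thus ?case using c by (simp add: field_simps)
    qed
    thus ?thesis using f(1) by (auto simp: mult_H2_def)
  next
    case True
    have "u w = 0" if "w \<in> ball 0 1" for w
    proof (rule Hinf_zero_moments[OF uH _ that])
      fix k
      have "(\<integral>z. hilbert_symbol z * J (\<lambda>z. z ^ k * boundary u z) z \<partial>circle_measure) = 0"
        using True powU by blast
      thus "(\<integral>x. complex_of_real x ^ k * u (complex_of_real x) \<partial>unit_interval) = 0"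
        by (simp add: J_def mult.assoc flip: hilbert_symbol_boundary_moment[OF u])
    qed
    hence "dilate u n z = 0" if "cmod z = 1" for n z
      using that by (simp add: dilate_eq[OF uH] cmod_radius_mult)
    hence boundary_0: "boundary u z = 0" if "cmod z = 1" for z
      using that by (simp add: boundary_def)
    have "AE z in circle_measure. (0 :: real) = 1"
      using bd AE_circle_cmod by eventually_elim (use boundary_0 in auto)
    thus ?thesis by (simp add: AE_circle_const)
  qed
qed

theorem corollary3p1:
  "{mult_H2 u | u. inner_function u} \<inter> Lat (hankel hilbert_symbol) = {H2}"
proof (intro equalityI subsetI)
  fix M assume "M \<in> {mult_H2 u | u. inner_function u} \<inter> Lat (hankel hilbert_symbol)"
  thus "M \<in> {H2}" using invariant_mult_H2 by auto
next
  fix M assume "M \<in> {H2}"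
  thus "M \<in> {mult_H2 u | u. inner_function u} \<inter> Lat (hankel hilbert_symbol)"
    using H2_in_Lat mult_H2_1 inner_function_1 by blast
qed

end
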